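(* Let $q$ be a prime power and $1 \le r \le n$ integers with $n\ge2$. Then $$\frac{\delta^{\mathrm{rk}}_q(r \times n, n, r)}{\delta^{\mathrm{rk}}_q(n \times n, r, n)} = \frac{|\mathrm{GL}_r(q)|}{|\mathrm{GL}_n(q)|}\cdot\frac{\begin{bmatrix} n^2\\ r\end{bmatrix}_q}{\begin{bmatrix} rn\\ n\end{bmatrix}_q}.$$ Moreover, $$\lim_{q \to+\infty} \frac{\delta^{\mathrm{rk}}_q(r \times n, n, r)}{\delta^{\mathrm{rk}}_q(n \times n, r, n)} = \lim_{n \to+\infty} \frac{\delta^{\mathrm{rk}}_q(r \times n, n, r)}{\delta^{\mathrm{rk}}_q(n \times n, r, n)} = 1,$$ where the first limit is over prime powers with $r,n$ fixed and the second has $q,r$ fixed.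
   Context: $\begin{bmatrix} a\\ b\end{bmatrix}_q=\prod_{j=0}^{b-1}\frac{q^a-q^j}{q^b-q^j}$. $\delta^{\mathrm{rk}}_q(a\times m,k,d)$ is the number of $k$-dimensional $\mathbb{F}_q$-linear subspaces of $\mathbb{F}_q^{a\times m}$ in which every nonzero matrix has rank at least $d$, divided by $\begin{bmatrix} am\\ k\end{bmatrix}_q$. $\mathrm{GL}_a(q)$ is the group of invertible $a\times a$ matrices over $\mathbb{F}_q$.
   Formalization: The limit as n tends to infinity is stated only for r at least 2; for r = 1 it is false for every q, since the ratio then tends to 1/prod_{i>=1}(1-q^{-i}), which is not 1 (about 3.46 for q = 2). *)

theory Defs
  imports
    Complex_Main
    "HOL-Number_Theory.Prime_Powers"
    "Jordan_Normal_Form.Matrix"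
    "Jordan_Normal_Form.Missing_VectorSpace"
begin

text \<open>
  The order \<open>q\<close> of the ground field varies inside the statement, so a field type class cannot be
  used: \<open>F\<^sub>q\<close> is a field structure with explicit carrier. A finite field can always be carried
  by natural numbers, exists for every prime power \<open>q\<close>, and is unique up to isomorphism; nothing
  below depends on which representative is chosen.
\<close>

definition GF :: "nat \<Rightarrow> nat ring" where
  "GF q = (SOME K. field K \<and> finite (carrier K) \<and> card (carrier K) = q)"

text \<open>
  The types \<open>'a vec\<close> and \<open>'a mat\<close> are only used as containers; all operations are
  those of the structure \<open>K\<close>. The ring multiplication and unit fields of the module records are
  irrelevant to the module structure.
\<close>

definition mats :: "('a, 'b) ring_scheme \<Rightarrow> nat \<Rightarrow> nat \<Rightarrow> 'a mat set" where
  "mats K a m = {A \<in> carrier_mat a m. \<forall>i<a. \<forall>j<m. A $$ (i, j) \<in> carrier K}"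

definition vec_module :: "('a, 'b) ring_scheme \<Rightarrow> nat \<Rightarrow> ('a, 'a vec) module" where
  "vec_module K a = \<lparr>
     carrier = {v \<in> carrier_vec a. \<forall>i<a. v $ i \<in> carrier K},
     mult = undefined,
     one = undefined,
     zero = vec a (\<lambda>i. \<zero>\<^bsub>K\<^esub>),
     add = (\<lambda>v w. vec a (\<lambda>i. v $ i \<oplus>\<^bsub>K\<^esub> w $ i)),
     smult = (\<lambda>c v. vec a (\<lambda>i. c \<otimes>\<^bsub>K\<^esub> v $ i))\<rparr>"

definition mat_module :: "('a, 'b) ring_scheme \<Rightarrow> nat \<Rightarrow> nat \<Rightarrow> ('a, 'a mat) module" where
  "mat_module K a m = \<lparr>
     carrier = mats K a m,
     mult = undefined,
     one = undefined,
     zero = mat a m (\<lambda>ij. \<zero>\<^bsub>K\<^esub>),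
     add = (\<lambda>A B. mat a m (\<lambda>ij. A $$ ij \<oplus>\<^bsub>K\<^esub> B $$ ij)),
     smult = (\<lambda>c A. mat a m (\<lambda>ij. c \<otimes>\<^bsub>K\<^esub> A $$ ij))\<rparr>"

definition mat_monoid :: "('a, 'b) ring_scheme \<Rightarrow> nat \<Rightarrow> 'a mat monoid" where
  "mat_monoid K a = \<lparr>
     carrier = mats K a a,
     mult = (\<lambda>A B. mat a a (\<lambda>(i, j). \<Oplus>\<^bsub>K\<^esub>k\<in>{..<a}. A $$ (i, k) \<otimes>\<^bsub>K\<^esub> B $$ (k, j))),
     one = mat a a (\<lambda>(i, j). if i = j then \<one>\<^bsub>K\<^esub> else \<zero>\<^bsub>K\<^esub>)\<rparr>"

definition GL :: "nat \<Rightarrow> nat \<Rightarrow> nat mat monoid" where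
  "GL a q = units_of (mat_monoid (GF q) a)"

definition mat_rank :: "('a, 'b) ring_scheme \<Rightarrow> 'a mat \<Rightarrow> nat" where
  "mat_rank K A =
     (let V = vec_module K (dim_row A)
      in vectorspace.dim K (V\<lparr>carrier := LinearCombinations.module.span K V (set (cols A))\<rparr>))"

definition q_binomial :: "nat \<Rightarrow> nat \<Rightarrow> nat \<Rightarrow> real" where
  "q_binomial q a b = (\<Prod>j<b. (real q ^ a - real q ^ j) / (real q ^ b - real q ^ j))"

definition rank_codes :: "('a, 'b) ring_scheme \<Rightarrow> nat \<Rightarrow> nat \<Rightarrow> nat \<Rightarrow> nat \<Rightarrow> 'a mat set set" where
  "rank_codes K a m k d =
     {C. subspace K C (mat_module K a m)
       \<and> vectorspace.dim K ((mat_module K a m)\<lparr>carrier := C\<rparr>) = k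
       \<and> (\<forall>A\<in>C. A \<noteq> \<zero>\<^bsub>mat_module K a m\<^esub> \<longrightarrow> d \<le> mat_rank K A)}"

definition delta_rk :: "nat \<Rightarrow> nat \<Rightarrow> nat \<Rightarrow> nat \<Rightarrow> nat \<Rightarrow> real" where
  "delta_rk q a m k d = real (card (rank_codes (GF q) a m k d)) / q_binomial q (a * m) k"

end

theory Submission
  imports
    Defs
    "HOL-Number_Theory.Residues"
    "HOL-Algebra.Algebraic_Closure"
begin

text \<open>
  A tuple of \<open>k\<close> matrices in \<open>F\<^sub>q\<^bsup>a\<times>m\<^esup>\<close> is an ordered basis of a code all of whose nonzero elements have
  full rank \<open>a\<close> iff its entries \<open>t(l,i,j)\<close> form a nonsingular tensor: the vector
  \<open>(\<Sum>\<^sub>l \<Sum>\<^sub>i c\<^sub>l x\<^sub>i t(l,i,j))\<^sub>j\<close> is nonzero for all nonzero \<open>c\<close> and \<open>x\<close>. This condition is symmetric under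
  exchanging the indices \<open>l\<close> and \<open>i\<close>. A code of dimension \<open>k\<close> has \<open>|GL\<^sub>k(q)|\<close> ordered bases, so the number
  of codes in \<open>F\<^sub>q\<^bsup>r\<times>n\<^esup>\<close> of dimension \<open>n\<close> times \<open>|GL\<^sub>n(q)|\<close> equals the number of codes in
  \<open>F\<^sub>q\<^bsup>n\<times>n\<^esup>\<close> of dimension \<open>r\<close> times \<open>|GL\<^sub>r(q)|\<close>. The latter number is not zero, because the structure
  constants of the extension field of degree \<open>n\<close>, found as the fixed points of \<open>x \<mapsto> x\<^bsup>q\<^sup>n\<^esup>\<close> in an
  algebraic closure, form a nonsingular tensor. The ratio of the densities therefore is
  \<open>(\<Prod>\<^sub>j\<^sub><\<^sub>r 1 - q\<^sup>j/q\<^bsup>n\<cdot>n\<^esup>) / (\<Prod>\<^sub>j\<^sub><\<^sub>n 1 - q\<^sup>j/q\<^bsup>r\<cdot>n\<^esup>)\<close>, from which both limits are read off.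
\<close>

section \<open>Finite fields\<close>

lemma (in cring) binomial_theorem:
  assumes x: "x \<in> carrier R" and y: "y \<in> carrier R"
  shows "(x \<oplus> y) [^] (n::nat) = (\<Oplus>k\<in>{..n}. [(n choose k)] \<cdot> (x [^] k \<otimes> y [^] (n - k)))"
proof (induction n)
  case 0
  show ?case using x y by simp
next
  case (Suc n)
  define t where "t m k = [(m choose k)] \<cdot> (x [^] k \<otimes> y [^] (m - k))" for m k
  have t: "t m k \<in> carrier R" for m k
    unfolding t_def using x y by simp
  \<comment> \<open>\<open>u k\<close> is the \<open>k\<close>-th term of row \<open>n\<close> times
    \<open>y\<close>. The exponent \<open>Suc n - k\<close> lets it make sense at
    \<open>k = Suc n\<close> too, where the binomial coefficient makes it vanish; so Pascal's rule
    takes the form \<open>S\<close> without a case distinction.\<close>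
  define u where "u k = [(n choose k)] \<cdot> (x [^] k \<otimes> y [^] (Suc n - k))" for k
  have u: "u k \<in> carrier R" for k
    unfolding u_def using x y by simp
  have S: "t (Suc n) (Suc k) = t n k \<otimes> x \<oplus> u (Suc k)" for k
    unfolding t_def u_def using x y
    by (simp add: add.nat_pow_mult[symmetric] add_pow_ldistr add_pow_rdistr m_ac)
  have T: "u k = t n k \<otimes> y" if "k \<le> n" for k
    unfolding t_def u_def using x y that
    by (simp add: add_pow_ldistr m_assoc Suc_diff_le)
  have un: "u (Suc n) = \<zero>" unfolding u_def using x y by (simp add: binomial_eq_0)
  have t0: "t (Suc n) 0 = u 0" unfolding t_def u_def using x y by simp
  have "(\<Oplus>k\<in>{..Suc n}. t (Suc n) k) = (\<Oplus>k\<in>{..n}. t n k \<otimes> x \<oplus> u (Suc k)) \<oplus> u 0"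
    using t by (subst finsum_Suc2) (auto simp: S[symmetric] t0)
  also have "\<dots> = (\<Oplus>k\<in>{..n}. t n k \<otimes> x) \<oplus> ((\<Oplus>k\<in>{..n}. u (Suc k)) \<oplus> u 0)"
    using t u x by (subst finsum_addf) (auto simp: a_assoc)
  also have "(\<Oplus>k\<in>{..n}. u (Suc k)) \<oplus> u 0 = (\<Oplus>k\<in>{..Suc n}. u k)"
    using u by (subst finsum_Suc2) auto
  also have "\<dots> = (\<Oplus>k\<in>{..n}. u k)"
    using u un by (simp add: finsum_Suc)
  also have "\<dots> = (\<Oplus>k\<in>{..n}. t n k \<otimes> y)"
    using T t y by (intro finsum_cong') auto
  also have "(\<Oplus>k\<in>{..n}. t n k \<otimes> x) \<oplus> (\<Oplus>k\<in>{..n}. t n k \<otimes> y) = (\<Oplus>k\<in>{..n}. t n k) \<otimes> (x \<oplus> y)"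
    using t x y by (simp add: finsum_ldistr r_distr)
  also have "(\<Oplus>k\<in>{..n}. t n k) = (x \<oplus> y) [^] n"
    unfolding t_def using Suc by simp
  finally show ?case
    unfolding t_def using x y by simp
qed

lemma (in cring) add_pow_eq_zero:
  assumes "[(p::nat)] \<cdot> \<one> = \<zero>" "p dvd m" "x \<in> carrier R"
  shows "[m] \<cdot> x = \<zero>"
proof -
  obtain k where k: "m = p * k" using assms(2) by blast
  have "[m] \<cdot> x = [k] \<cdot> ([p] \<cdot> (\<one> \<otimes> x))"
    using assms k by (simp add: add.nat_pow_pow)
  also have "[p] \<cdot> (\<one> \<otimes> x) = ([p] \<cdot> \<one>) \<otimes> x"
    using assms(3) add_pow_ldistr[of \<one> x p] by simp
  finally show ?thesis using assms by simp
qed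

text \<open>For exponent \<open>p\<close> every binomial coefficient strictly between the ends is
  divisible by \<open>p\<close>, so only the two outer terms of the binomial theorem survive.
  Iterating gives the powers of \<open>p\<close>.\<close>

lemma (in cring) frobenius_add:
  assumes p: "Factorial_Ring.prime p" and char: "[(p::nat)] \<cdot> \<one> = \<zero>"
    and x: "x \<in> carrier R" and y: "y \<in> carrier R"
  shows "(x \<oplus> y) [^] (p ^ e) = x [^] (p ^ e) \<oplus> y [^] (p ^ e)"
proof (induction e)
  case 0
  show ?case using x y by simp
next
  case (Suc e)
  have prime_case: "(a \<oplus> b) [^] p = a [^] p \<oplus> b [^] p"
    if a: "a \<in> carrier R" and b: "b \<in> carrier R" for a b
  proof -
    obtain m where m: "p = Suc m" using prime_gt_0_nat[OF p] by (cases p) auto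
    have z: "[(p choose k)] \<cdot> (a [^] k \<otimes> b [^] (p - k)) = \<zero>" if "k \<in> {1..m}" for k
      using that a b m by (intro add_pow_eq_zero[OF char] dvd_choose_prime[OF _ _ _ p]) auto
    have "(a \<oplus> b) [^] p = (\<Oplus>k\<in>{..Suc m}. [(p choose k)] \<cdot> (a [^] k \<otimes> b [^] (p - k)))"
      using binomial_theorem[OF a b, of p] by (simp add: m)
    also have "\<dots> = a [^] p \<oplus> (\<Oplus>k\<in>{..m}. [(p choose k)] \<cdot> (a [^] k \<otimes> b [^] (p - k)))"
      using a b by (subst finsum_Suc) (auto simp: m)
    also have "(\<Oplus>k\<in>{..m}. [(p choose k)] \<cdot> (a [^] k \<otimes> b [^] (p - k)))
        = (\<Oplus>k\<in>{..m}. if k = 0 then b [^] p else \<zero>)"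
      using a b z by (intro finsum_cong') auto
    also have "\<dots> = b [^] p"
      using add.finprod_singleton_swap[of 0 "{..m}" "\<lambda>_. b [^] p"] b by simp
    finally show ?thesis .
  qed
  show ?case
    using Suc x y prime_case by (simp add: mult.commute[of p] nat_pow_pow[symmetric])
qed

section \<open>Powers and the characteristic in a finite field\<close>

lemma (in field) pow_card_eq_self:
  assumes "finite (carrier R)" "x \<in> carrier R"
  shows "x [^] card (carrier R) = x"
proof (cases "x = \<zero>")
  case True
  then show ?thesis using assms
    by (metis card_gt_0_iff empty_iff nat_pow_zero neq0_conv)
next
  case False
  then have "x \<in> Units R" using assms field_Units by auto
  then have "x [^] card (Units R) = \<one>"
    using assms by (intro units_power_order_eq_one) (auto simp: field_Units)
  moreover have "card (carrier R) = Suc (card (Units R))"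
    using assms field_Units by (metis card.remove zero_closed)
  ultimately show ?thesis using assms by simp
qed

text \<open>The order \<open>p ^ e\<close> of the additive group annihilates \<open>\<one>\<close>.
  This multiple of \<open>\<one>\<close> is the \<open>e\<close>-th power of
  \<open>[p] \<cdot> \<one>\<close>, and a field has no nonzero nilpotent elements.\<close>

lemma (in field) char_of_prime_power_card:
  assumes "finite (carrier R)" "card (carrier R) = p ^ e"
  shows "[(p::nat)] \<cdot> \<one> = \<zero>"
proof -
  have "[(p ^ e)] \<cdot> \<one> = \<zero>"
    using add.pow_order_eq_1[of \<one>] assms by (simp add: order_def)
  moreover have "[(p ^ e)] \<cdot> \<one> = ([p] \<cdot> \<one>) [^] e" for e :: nat
  proof (induction e)
    case (Suc e)
    have "[(p ^ Suc e)] \<cdot> \<one> = [p] \<cdot> ([(p ^ e)] \<cdot> \<one>)"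
      by (simp add: add.nat_pow_pow mult.commute)
    also have "\<dots> = ([(p ^ e)] \<cdot> \<one>) \<otimes> ([p] \<cdot> \<one>)"
      by (simp add: add_pow_rdistr)
    finally show ?case using Suc by simp
  qed auto
  moreover have "x [^] e \<noteq> \<zero>" if "x \<in> carrier R" "x \<noteq> \<zero>" for x and e :: nat
    using that by (induction e) (auto simp: integral_iff)
  ultimately show ?thesis
    by (metis add.nat_pow_closed one_closed)
qed

text \<open>The cofactor \<open>r\<close> is the sum of all \<open>x^i c^(n-i)\<close>, whose
  \<open>n + 1\<close> terms have the same image once \<open>h x = h c\<close>. With
  \<open>h\<close> the evaluation of polynomials at a point, this replaces the derivative of a power
  in the proof that certain roots are simple.\<close>

lemma (in ring_hom_cring) pow_diff_factor:
  assumes x: "x \<in> carrier R" and c: "c \<in> carrier R" and eq: "h x = h c"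
  shows "\<exists>r\<in>carrier R. x [^] Suc n \<ominus> c [^] Suc n = (x \<ominus> c) \<otimes> r
           \<and> h r = add_pow S (Suc n) (h c [^]\<^bsub>S\<^esub> n)"
proof (induction n)
  case 0
  show ?case using x c by (intro bexI[of _ \<one>]) auto
next
  case (Suc n)
  then obtain r where r: "r \<in> carrier R" "x [^] Suc n \<ominus> c [^] Suc n = (x \<ominus> c) \<otimes> r"
    "h r = add_pow S (Suc n) (h c [^]\<^bsub>S\<^esub> n)" by blast
  define u v where "u = x [^] Suc n" and "v = c [^] Suc n"
  have uv: "u \<in> carrier R" "v \<in> carrier R" unfolding u_def v_def using x c by auto
  have "x [^] Suc (Suc n) \<ominus> c [^] Suc (Suc n) = u \<otimes> x \<ominus> v \<otimes> c"
    unfolding u_def v_def by simp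
  also have "\<dots> = (u \<ominus> v) \<otimes> x \<oplus> v \<otimes> (x \<ominus> c)"
    using x c uv by algebra
  also have "\<dots> = (x \<ominus> c) \<otimes> (r \<otimes> x \<oplus> v)"
    unfolding r(2)[folded u_def v_def] using x c uv r(1) by algebra
  finally have 1: "x [^] Suc (Suc n) \<ominus> c [^] Suc (Suc n) = (x \<ominus> c) \<otimes> (r \<otimes> x \<oplus> v)" .
  have hv: "h v = h c [^]\<^bsub>S\<^esub> Suc n"
    unfolding v_def using c by simp
  have "h (r \<otimes> x \<oplus> v) = add_pow S (Suc n) (h c [^]\<^bsub>S\<^esub> n) \<otimes>\<^bsub>S\<^esub> h c \<oplus>\<^bsub>S\<^esub> h c [^]\<^bsub>S\<^esub> Suc n"
    using r x c uv eq by (simp add: hv)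
  also have "add_pow S (Suc n) (h c [^]\<^bsub>S\<^esub> n) \<otimes>\<^bsub>S\<^esub> h c = add_pow S (Suc n) (h c [^]\<^bsub>S\<^esub> Suc n)"
    using c by (subst S.add_pow_ldistr) auto
  finally have 2: "h (r \<otimes> x \<oplus> v) = add_pow S (Suc (Suc n)) (h c [^]\<^bsub>S\<^esub> Suc n)"
    using c by simp
  show ?case
    using 1 2 r(1) x uv by (intro bexI[of _ "r \<otimes> x \<oplus> v"]) auto
qed

text \<open>The fixed points are the roots of \<open>X^N - X\<close>, which splits with
  \<open>N\<close> roots counted with multiplicity. All roots are simple because the formal
  derivative \<open>N X^(N-1) - 1\<close> is the constant \<open>-1\<close>; the proof expresses
  this through factorizations instead of derivatives.\<close>

lemma (in algebraically_closed) card_pow_fixed_points: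
  assumes N: "1 < N" and char: "[(N::nat)] \<cdot> \<one> = \<zero>"
  shows "finite {x \<in> carrier L. x [^] N = x} \<and> card {x \<in> carrier L. x [^] N = x} = N"
proof -
  let ?P = "poly_ring L"
  interpret UP: domain ?P
    using univ_poly_is_domain[OF carrier_is_subring] .
  define x where "x = var L"
  have x: "x \<in> carrier ?P" and degx: "degree x = 1"
    unfolding x_def using var_closed(1)[OF carrier_is_subring] by (auto simp: var_def)
  define f where "f = x [^]\<^bsub>?P\<^esub> N \<ominus>\<^bsub>?P\<^esub> x"
  have f: "f \<in> carrier ?P" unfolding f_def using x by simp
  have degf: "degree f = N"
  proof -
    have "degree (\<ominus>\<^bsub>?P\<^esub> x) = 1"
      using degx univ_poly_a_inv_degree[OF carrier_is_subring x] by simp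
    moreover have "degree (x [^]\<^bsub>?P\<^esub> N) = N"
      using polynomial_pow_degree[OF x] degx by simp
    ultimately show ?thesis
      unfolding f_def a_minus_def univ_poly_add using N x
      by (subst poly_add_degree_eq[OF carrier_is_subring]) (auto simp: univ_poly_carrier)
  qed
  have f0: "f \<noteq> []" using degf N by auto
  have ev: "eval f a = a [^] N \<ominus> a" if a: "a \<in> carrier L" for a
  proof -
    interpret E: ring_hom_cring ?P L "\<lambda>p. eval p a"
      using eval_cring_hom[OF carrier_is_subring a] .
    show ?thesis unfolding f_def using x a eval_var[OF a]
      by (simp add: E.hom_pow a_minus_def x_def)
  qed
  have roots_set: "set_mset (roots f) = {x \<in> carrier L. x [^] N = x}"
    using roots_mem_iff_is_root[OF f] ev f0 r_right_minus_eq unfolding is_root_def by auto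
  have simple: "count (roots f) a \<le> 1" for a
  proof (rule ccontr)
    assume "\<not> count (roots f) a \<le> 1"
    then have ge2: "2 \<le> alg_mult f a" using alg_mult_eq_count_roots[OF f] by simp
    then have "a \<in># roots f" using alg_mult_eq_count_roots[OF f]
      by (metis count_eq_zero_iff not_numeral_le_zero)
    then have a: "a \<in> carrier L" and aN: "a [^] N = a" using roots_set by auto
    interpret E: ring_hom_cring ?P L "\<lambda>p. eval p a"
      using eval_cring_hom[OF carrier_is_subring a] .
    define l where "l = [\<one>, \<ominus> a]"
    have l: "l \<in> carrier ?P" and l0: "l \<noteq> \<zero>\<^bsub>?P\<^esub>"
      unfolding l_def univ_poly_carrier[symmetric] using a by (auto simp: polynomial_def univ_poly_zero)
    interpret C: ring_hom_ring L ?P poly_of_const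
      using canonical_embedding_ring_hom[OF carrier_is_subring] by simp
    \<comment> \<open>Since \<open>a\<close> is a fixed point, the constant polynomial
      \<open>c\<close> satisfies \<open>c^N = c\<close>. Hence \<open>f\<close> equals
      \<open>(x^N - c^N) - (x - c)\<close>, which is \<open>l\<close> times \<open>r - 1\<close> for
      a cofactor \<open>r\<close> whose value at \<open>a\<close> is
      \<open>N a^(N-1) = 0\<close>.\<close>
    define c where "c = poly_of_const a"
    have c: "c \<in> carrier ?P" unfolding c_def using a by simp
    have cN: "c [^]\<^bsub>?P\<^esub> N = c"
      unfolding c_def using C.hom_nat_pow[OF a, of N] aN by simp
    have xc: "x \<ominus>\<^bsub>?P\<^esub> c = l"
    proof -
      have "\<ominus>\<^bsub>?P\<^esub> c = poly_of_const (\<ominus> a)" unfolding c_def using a by simp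
      then show ?thesis
        unfolding a_minus_def univ_poly_add x_def l_def var_def poly_of_const_def using a by auto
    qed
    have hx: "eval x a = a" and hc: "eval c a = a"
      using a eval_var[OF a] unfolding x_def c_def poly_of_const_def by auto
    obtain m where m: "N = Suc m" using N by (cases N) auto
    obtain r where r: "r \<in> carrier ?P" "x [^]\<^bsub>?P\<^esub> N \<ominus>\<^bsub>?P\<^esub> c [^]\<^bsub>?P\<^esub> N = l \<otimes>\<^bsub>?P\<^esub> r"
      "eval r a = [N] \<cdot> (a [^] m)"
      using E.pow_diff_factor[OF x c, of m] hx hc m xc by auto
    have ra: "eval r a = \<zero>" using r(3) add_pow_eq_zero[OF char, of N] a by simp
    have "l [^]\<^bsub>?P\<^esub> (2::nat) pdivides f"
      using le_alg_mult_imp_pdivides[OF a f ge2] unfolding l_def .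
    then obtain g where g: "g \<in> carrier ?P" "f = (l \<otimes>\<^bsub>?P\<^esub> l) \<otimes>\<^bsub>?P\<^esub> g"
      unfolding pdivides_def factor_def using l by (auto simp: numeral_2_eq_2)
    have "f = (x [^]\<^bsub>?P\<^esub> N \<ominus>\<^bsub>?P\<^esub> c [^]\<^bsub>?P\<^esub> N) \<ominus>\<^bsub>?P\<^esub> (x \<ominus>\<^bsub>?P\<^esub> c)"
    proof -
      have "x [^]\<^bsub>?P\<^esub> N \<in> carrier ?P" using x by simp
      then show ?thesis unfolding f_def cN using x c by algebra
    qed
    then have "f = l \<otimes>\<^bsub>?P\<^esub> (r \<ominus>\<^bsub>?P\<^esub> \<one>\<^bsub>?P\<^esub>)"
      unfolding r(2) xc using l r(1) by algebra
    \<comment> \<open>A double root makes \<open>f\<close> divisible by \<open>l\<close> twice.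
      Cancelling one factor shows that \<open>l\<close> divides \<open>r - 1\<close>, and evaluating
      at \<open>a\<close> yields the contradiction \<open>-1 = 0\<close>.\<close>
    then have "l \<otimes>\<^bsub>?P\<^esub> (r \<ominus>\<^bsub>?P\<^esub> \<one>\<^bsub>?P\<^esub>) = l \<otimes>\<^bsub>?P\<^esub> (l \<otimes>\<^bsub>?P\<^esub> g)"
      using g l by (simp add: UP.m_assoc)
    then have "r \<ominus>\<^bsub>?P\<^esub> \<one>\<^bsub>?P\<^esub> = l \<otimes>\<^bsub>?P\<^esub> g"
      using UP.m_lcancel[OF l0 l] g l r(1) by simp
    then have "eval (r \<ominus>\<^bsub>?P\<^esub> \<one>\<^bsub>?P\<^esub>) a = eval (l \<otimes>\<^bsub>?P\<^esub> g) a" by simp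
    moreover have "eval l a = \<zero>"
      unfolding l_def using a by (simp add: r_neg)
    ultimately have "\<zero> \<ominus> \<one> = \<zero>"
      using r(1) l g ra by (simp add: a_minus_def)
    then show False by (simp add: a_minus_def)
  qed
  have "N = size (roots f)"
    using roots_over_carrier[OF f] degf unfolding splitted_def by simp
  also have "\<dots> = (\<Sum>a\<in>set_mset (roots f). count (roots f) a)"
    by (simp add: size_multiset_overloaded_eq)
  also have "\<dots> = (\<Sum>a\<in>set_mset (roots f). 1)"
    by (intro sum.cong) (use simple in \<open>auto simp: le_Suc_eq count_eq_zero_iff\<close>)
  finally show ?thesis using roots_set by (metis card_eq_sum finite_set_mset)
qed

text \<open>Inside the algebraic closure, the fixed points of a power of the Frobenius map form a
  subfield with exactly \<open>N\<close> elements, and it contains the image of \<open>R\<close>.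
  The type of \<open>L\<close> is the one on which \<open>alg_closure\<close> is built, as an
  existential statement cannot leave a type open.\<close>

lemma (in field) finite_extension_exists:
  assumes fin: "finite (carrier R)" and card: "card (carrier R) = p ^ e"
    and p: "Factorial_Ring.prime p" and n: "0 < n"
  shows "\<exists>L h. field (L :: (('a list \<times> nat) multiset \<Rightarrow> 'a) ring) \<and> finite (carrier L)
           \<and> card (carrier L) = card (carrier R) ^ n \<and> h \<in> ring_hom R L"
proof -
  define h where "h = (indexed_const :: 'a \<Rightarrow> ('a list \<times> nat) multiset \<Rightarrow> 'a)"
  interpret L: algebraic_closure alg_closure "h ` carrier R"
    unfolding h_def by (rule alg_closureE(1))
  interpret h: ring_hom_ring R alg_closure h
    using alg_closureE(2) L.ring_axioms ring_axioms unfolding h_def by (intro ring_hom_ringI2)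
  let ?L = "alg_closure"
  define N where "N = card (carrier R) ^ n"
  have N: "N = p ^ (e * n)" unfolding N_def card by (simp add: power_mult)
  have "2 \<le> card (carrier R)"
    using card_mono[OF fin, of "{\<zero>, \<one>}"] zero_not_one by auto
  then have N1: "1 < N" unfolding N_def using n by (intro one_less_power) auto
  have charp: "add_pow ?L p \<one>\<^bsub>?L\<^esub> = \<zero>\<^bsub>?L\<^esub>"
  proof -
    have "h (add_pow R m \<one>) = add_pow ?L m \<one>\<^bsub>?L\<^esub>" for m :: nat
      by (induction m) auto
    then show ?thesis using char_of_prime_power_card[OF fin card] h.hom_zero by metis
  qed
  have en: "0 < e * n" using N N1 by (cases "e * n = 0") auto
  then have "p dvd N" using N by (auto intro: dvd_power)
  then have charN: "add_pow ?L N \<one>\<^bsub>?L\<^esub> = \<zero>\<^bsub>?L\<^esub>"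
    using L.add_pow_eq_zero[OF charp] by simp
  define S where "S = {x \<in> carrier ?L. x [^]\<^bsub>?L\<^esub> N = x}"
  have S: "finite S" "card S = N"
    using L.card_pow_fixed_points[OF N1 charN] unfolding S_def by auto
  \<comment> \<open>Closure under negation is obtained by applying additivity of the power map to
    \<open>x + (-x) = 0\<close>, which treats odd and even characteristic alike.\<close>
  have neg1: "(\<ominus>\<^bsub>?L\<^esub> x) [^]\<^bsub>?L\<^esub> N = \<ominus>\<^bsub>?L\<^esub> x" if "x \<in> S" for x
  proof -
    have x: "x \<in> carrier ?L" "x [^]\<^bsub>?L\<^esub> N = x" using that unfolding S_def by auto
    have "\<zero>\<^bsub>?L\<^esub> = (x \<oplus>\<^bsub>?L\<^esub> \<ominus>\<^bsub>?L\<^esub> x) [^]\<^bsub>?L\<^esub> N"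
      using x N1 by (simp add: L.r_neg L.nat_pow_zero)
    also have "\<dots> = x [^]\<^bsub>?L\<^esub> N \<oplus>\<^bsub>?L\<^esub> (\<ominus>\<^bsub>?L\<^esub> x) [^]\<^bsub>?L\<^esub> N"
      using x L.frobenius_add[OF p charp, of x "\<ominus>\<^bsub>?L\<^esub> x" "e * n"] by (simp add: N)
    finally have "x \<oplus>\<^bsub>?L\<^esub> (\<ominus>\<^bsub>?L\<^esub> x) [^]\<^bsub>?L\<^esub> N = \<zero>\<^bsub>?L\<^esub>" using x by simp
    then show ?thesis using x
      by (metis L.add.inv_closed L.minus_equality L.minus_minus L.nat_pow_closed L.a_comm)
  qed
  have sub: "subfield S ?L"
  proof (rule L.subfieldI')
    show "subring S ?L"
    proof (rule L.subringI)
      show "S \<subseteq> carrier ?L" "\<one>\<^bsub>?L\<^esub> \<in> S" unfolding S_def by auto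
      show "\<ominus>\<^bsub>?L\<^esub> x \<in> S" if "x \<in> S" for x
        using neg1[OF that] that unfolding S_def by auto
      show "x \<otimes>\<^bsub>?L\<^esub> y \<in> S" if "x \<in> S" "y \<in> S" for x y
        using that unfolding S_def by (auto simp: L.nat_pow_distrib)
      show "x \<oplus>\<^bsub>?L\<^esub> y \<in> S" if "x \<in> S" "y \<in> S" for x y
        using that L.frobenius_add[OF p charp, of x y "e * n"] unfolding S_def N by auto
    qed
    show "inv\<^bsub>?L\<^esub> x \<in> S" if "x \<in> S - {\<zero>\<^bsub>?L\<^esub>}" for x
    proof -
      have x: "x \<in> Units ?L" "x [^]\<^bsub>?L\<^esub> N = x" using that L.field_Units unfolding S_def by auto
      have "x \<otimes>\<^bsub>?L\<^esub> (inv\<^bsub>?L\<^esub> x) [^]\<^bsub>?L\<^esub> N = (x \<otimes>\<^bsub>?L\<^esub> inv\<^bsub>?L\<^esub> x) [^]\<^bsub>?L\<^esub> N"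
        using x by (metis L.nat_pow_distrib L.Units_closed L.Units_inv_closed)
      also have "\<dots> = \<one>\<^bsub>?L\<^esub>" using x by simp
      finally have "(inv\<^bsub>?L\<^esub> x) [^]\<^bsub>?L\<^esub> N = inv\<^bsub>?L\<^esub> x"
        using x by (metis L.Units_closed L.Units_inv_closed L.comm_inv_char L.nat_pow_closed)
      then show ?thesis using x unfolding S_def by auto
    qed
  qed
  let ?F = "?L\<lparr>carrier := S\<rparr>"
  have "field ?F" using sub L.subfield_iff(2) by blast
  moreover have "h \<in> ring_hom R ?F"
  proof -
    have "h x \<in> S" if x: "x \<in> carrier R" for x
    proof -
      \<comment> \<open>Iterating \<open>x^|R| = x\<close> shows that elements of \<open>R\<close>
        stay fixed under every power of this map, so their images lie in \<open>S\<close>.\<close>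
      have fix1: "x [^] (card (carrier R) ^ k) = x" for k
        using pow_card_eq_self[OF fin x] x
        by (induction k) (auto simp: mult.commute[of "card _"] nat_pow_pow[symmetric])
      show ?thesis
        unfolding S_def N_def using x h.hom_nat_pow[OF x, of "card (carrier R) ^ n"] fix1[of n] by auto
    qed
    then show ?thesis unfolding ring_hom_def by auto
  qed
  ultimately show ?thesis
    using S unfolding N_def by (intro exI[of _ ?F] exI[of _ h]) auto
qed

text \<open>The choice in \<open>GF\<close> is from a nonempty set: the extension of degree
  \<open>k\<close> of the integers modulo \<open>p\<close> has \<open>q\<close> elements, and an
  injection of its finite carrier into the naturals transports the field structure.\<close>

lemma GF:
  assumes "primepow q"
  shows "field (GF q)" "finite (carrier (GF q))" "card (carrier (GF q)) = q"
proof -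
  obtain p k where p: "Factorial_Ring.prime p" and k: "k > 0" and q: "q = p ^ k"
    using assms by (auto simp: primepow_def)
  define Z where "Z = residue_ring (int p)"
  interpret Z: residues_prime p Z
    by unfold_locales (auto simp: p Z_def)
  have carZ: "carrier Z = {0..int p - 1}" by (simp add: Z_def residue_ring_def)
  have "finite (carrier Z)" "card (carrier Z) = p ^ 1"
    using carZ prime_gt_0_nat[OF p] by auto
  from Z.finite_extension_exists[OF this p k] obtain L :: "((int list \<times> nat) multiset \<Rightarrow> int) ring"
    where L: "field L" "finite (carrier L)" "card (carrier L) = q"
    using q carZ prime_gt_0_nat[OF p] by auto
  obtain f :: "((int list \<times> nat) multiset \<Rightarrow> int) \<Rightarrow> nat" where f: "inj_on f (carrier L)"
    using finite_imp_inj_to_nat_seg[OF L(2)] by blast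
  have "field (image_ring f L)" "finite (carrier (image_ring f L))" "card (carrier (image_ring f L)) = q"
    using field.inj_imp_image_ring_is_field[OF L(1) f] L f by (auto simp: image_ring_carrier card_image)
  then have "\<exists>K :: nat ring. field K \<and> finite (carrier K) \<and> card (carrier K) = q" by blast
  from someI_ex[OF this]
  show "field (GF q)" "finite (carrier (GF q))" "card (carrier (GF q)) = q"
    unfolding GF_def by auto
qed

section \<open>Counting linearly independent tuples\<close>

text \<open>In contrast to a \<open>finsum\<close> over the index set, this does not refer to the carrier of the module, so
  it is unchanged when passing to a subspace.\<close>

primrec lcomb :: "('a, 'c, 'd) module_scheme \<Rightarrow> (nat \<Rightarrow> 'a) \<Rightarrow> (nat \<Rightarrow> 'c) \<Rightarrow> nat \<Rightarrow> 'c" where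
  "lcomb M c f 0 = \<zero>\<^bsub>M\<^esub>"
| "lcomb M c f (Suc k) = lcomb M c f k \<oplus>\<^bsub>M\<^esub> (c k \<odot>\<^bsub>M\<^esub> f k)"

text \<open>Extensional functions, so that distinct elements are distinct \<open>k\<close>-tuples
  and can be counted.\<close>

abbreviation coords :: "('a, 'b) ring_scheme \<Rightarrow> nat \<Rightarrow> (nat \<Rightarrow> 'a) set" where
  "coords K k \<equiv> {..<k} \<rightarrow>\<^sub>E carrier K"

definition lspan ::
    "('a, 'b) ring_scheme \<Rightarrow> ('a, 'c, 'd) module_scheme \<Rightarrow> nat \<Rightarrow> (nat \<Rightarrow> 'c) \<Rightarrow> 'c set" where
  "lspan K V k f = (\<lambda>c. lcomb V c f k) ` coords K k"

text \<open>These are the ordered linearly independent \<open>k\<close>-tuples; they are ordered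
  bases when \<open>V\<close> has dimension \<open>k\<close>.\<close>

definition frames ::
    "('a, 'b) ring_scheme \<Rightarrow> ('a, 'c, 'd) module_scheme \<Rightarrow> nat \<Rightarrow> (nat \<Rightarrow> 'c) set" where
  "frames K V k = {f \<in> {..<k} \<rightarrow>\<^sub>E carrier V.
     \<forall>c\<in>coords K k. lcomb V c f k = \<zero>\<^bsub>V\<^esub> \<longrightarrow> (\<forall>i<k. c i = \<zero>\<^bsub>K\<^esub>)}"

lemma lcomb_carrier_update [simp]: "lcomb (M\<lparr>carrier := C\<rparr>) c f k = lcomb M c f k"
  by (induction k) auto

lemma lcomb_cong:
  assumes "\<And>i. i < k \<Longrightarrow> c i = d i" "\<And>i. i < k \<Longrightarrow> f i = g i"
  shows "lcomb M c f k = lcomb M d g k"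
  using assms by (induction k) auto

lemma lcomb_restrict [simp]:
  "lcomb M (restrict c {..<k}) f k = lcomb M c f k"
  "lcomb M c (restrict f {..<k}) k = lcomb M c f k"
  by (auto intro: lcomb_cong)

lemma coords_Pi: "c \<in> coords K k \<Longrightarrow> c \<in> {..<k} \<rightarrow> carrier K"
  by (simp add: PiE_def)

lemma lspanI:
  assumes "c \<in> {..<k} \<rightarrow> carrier K"
  shows "lcomb V c f k \<in> lspan K V k f"
proof -
  have "restrict c {..<k} \<in> coords K k" using assms by auto
  then show ?thesis unfolding lspan_def by (metis imageI lcomb_restrict(1))
qed

lemma framesD:
  assumes "f \<in> frames K V k" "c \<in> coords K k" "lcomb V c f k = \<zero>\<^bsub>V\<^esub>" "i < k"
  shows "c i = \<zero>\<^bsub>K\<^esub>"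
  using assms unfolding frames_def by blast

lemma (in abelian_monoid) finsum_lessThan_Suc:
  assumes "f \<in> {..<Suc k} \<rightarrow> carrier G"
  shows "(\<Oplus>i\<in>{..<Suc k}. f i) = (\<Oplus>i\<in>{..<k}. f i) \<oplus> f k"
proof -
  have "f k \<in> carrier G" "f \<in> {..<k} \<rightarrow> carrier G" using assms by auto
  then show ?thesis by (simp add: lessThan_Suc a_comm)
qed

section \<open>Linear combinations and spans of tuples in a module\<close>

context module
begin

lemma lcomb_closed:
  assumes "c \<in> {..<k} \<rightarrow> carrier R" "f \<in> {..<k} \<rightarrow> carrier M"
  shows "lcomb M c f k \<in> carrier M"
  using assms by (induction k) (auto simp: Pi_iff)

lemma lcomb_add:
  assumes "c \<in> {..<k} \<rightarrow> carrier R" "d \<in> {..<k} \<rightarrow> carrier R" "f \<in> {..<k} \<rightarrow> carrier M"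
  shows "lcomb M (\<lambda>i. c i \<oplus> d i) f k = lcomb M c f k \<oplus>\<^bsub>M\<^esub> lcomb M d f k"
  using assms
proof (induction k)
  case (Suc k)
  then have "lcomb M c f k \<in> carrier M" "lcomb M d f k \<in> carrier M"
    by (auto intro!: lcomb_closed simp: Pi_iff)
  moreover have "c k \<odot>\<^bsub>M\<^esub> f k \<in> carrier M" "d k \<odot>\<^bsub>M\<^esub> f k \<in> carrier M"
    using Suc by (auto simp: Pi_iff)
  ultimately show ?case
    using Suc by (simp add: Pi_iff smult_l_distr M.add.m_ac)
qed auto

lemma lcomb_smult:
  assumes "c \<in> {..<k} \<rightarrow> carrier R" "a \<in> carrier R" "f \<in> {..<k} \<rightarrow> carrier M"
  shows "lcomb M (\<lambda>i. a \<otimes> c i) f k = a \<odot>\<^bsub>M\<^esub> lcomb M c f k"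
  using assms
proof (induction k)
  case (Suc k)
  then have "lcomb M c f k \<in> carrier M"
    by (auto intro!: lcomb_closed simp: Pi_iff)
  then show ?case
    using Suc by (simp add: Pi_iff smult_r_distr smult_assoc1)
qed auto

lemma lcomb_zero:
  assumes "f \<in> {..<k} \<rightarrow> carrier M" "\<And>i. i < k \<Longrightarrow> c i = \<zero>"
  shows "lcomb M c f k = \<zero>\<^bsub>M\<^esub>"
  using assms by (induction k) (auto simp: Pi_iff)

lemma lcomb_unit:
  assumes "f \<in> {..<k} \<rightarrow> carrier M" "j < k"
  shows "lcomb M (\<lambda>i. if i = j then \<one> else \<zero>) f k = f j"
  using assms
proof (induction k)
  case (Suc k)
  show ?case
  proof (cases "j = k")
    case True
    then show ?thesis using Suc.prems lcomb_zero[of f k "\<lambda>i. if i = j then \<one> else \<zero>"]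
      by (auto simp: Pi_iff)
  next
    case False
    then show ?thesis using Suc by (auto simp: Pi_iff)
  qed
qed auto

lemma lcomb_in_submodule:
  assumes "submodule R N M" "c \<in> {..<k} \<rightarrow> carrier R" "f \<in> {..<k} \<rightarrow> N"
  shows "lcomb M c f k \<in> N"
  using assms(2,3)
  by (induction k) (auto simp: Pi_iff intro!: submodule.m_closed[OF assms(1)]
      submodule.smult_closed[OF assms(1)] submodule.zero_closed[OF assms(1)])

text \<open>Interchange of summation in a combination of combinations. In the structure constant
  argument it is applied once for each of the two factors of a product.\<close>

lemma lcomb_finsum:
  assumes "x \<in> {..<k} \<rightarrow> carrier R" "\<And>l. l < k \<Longrightarrow> g l \<in> {..<n} \<rightarrow> carrier R"
    "e \<in> {..<n} \<rightarrow> carrier M"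
  shows "lcomb M (\<lambda>j. \<Oplus>l\<in>{..<k}. x l \<otimes> g l j) e n = lcomb M x (\<lambda>l. lcomb M (g l) e n) k"
  using assms(1,2)
proof (induction k)
  case 0
  then show ?case using lcomb_zero[of e n] assms(3) by simp
next
  case (Suc k)
  have "lcomb M (\<lambda>j. \<Oplus>l\<in>{..<Suc k}. x l \<otimes> g l j) e n
      = lcomb M (\<lambda>j. (\<Oplus>l\<in>{..<k}. x l \<otimes> g l j) \<oplus> x k \<otimes> g k j) e n"
    using Suc.prems by (intro lcomb_cong) (auto simp: R.finsum_lessThan_Suc Pi_iff)
  also have "\<dots> = lcomb M (\<lambda>j. \<Oplus>l\<in>{..<k}. x l \<otimes> g l j) e n \<oplus>\<^bsub>M\<^esub> lcomb M (\<lambda>j. x k \<otimes> g k j) e n"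
    using Suc.prems assms(3) by (intro lcomb_add) (auto simp: Pi_iff)
  also have "lcomb M (\<lambda>j. x k \<otimes> g k j) e n = x k \<odot>\<^bsub>M\<^esub> lcomb M (g k) e n"
    using Suc.prems assms(3) by (intro lcomb_smult) (auto simp: Pi_iff)
  finally show ?case using Suc by (auto simp: Pi_iff)
qed

lemma lspan_subset:
  assumes "submodule R N M" "f \<in> {..<k} \<rightarrow> N"
  shows "lspan R M k f \<subseteq> N"
  unfolding lspan_def using assms by (auto intro!: lcomb_in_submodule)

lemma submodule_lspan:
  assumes f: "f \<in> {..<k} \<rightarrow> carrier M"
  shows "submodule R (lspan R M k f) M"
proof
  show "lspan R M k f \<subseteq> carrier M"
    unfolding lspan_def using f by (auto intro!: lcomb_closed)
  show "\<zero>\<^bsub>M\<^esub> \<in> lspan R M k f"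
    using lspanI[of "\<lambda>i. \<zero>" k R M f] lcomb_zero[OF f, of "\<lambda>i. \<zero>"] by simp
next
  fix v w assume "v \<in> lspan R M k f" "w \<in> lspan R M k f"
  then obtain c d where cd: "c \<in> coords R k" "d \<in> coords R k" "v = lcomb M c f k" "w = lcomb M d f k"
    unfolding lspan_def by auto
  then have "v \<oplus>\<^bsub>M\<^esub> w = lcomb M (\<lambda>i. c i \<oplus> d i) f k"
    using lcomb_add[OF coords_Pi coords_Pi f] by simp
  moreover have "(\<lambda>i. c i \<oplus> d i) \<in> {..<k} \<rightarrow> carrier R" using cd(1,2) by auto
  ultimately show "v \<oplus>\<^bsub>M\<^esub> w \<in> lspan R M k f"
    using lspanI by simp
next
  fix a v assume a: "a \<in> carrier R" and "v \<in> lspan R M k f"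
  then obtain c where c: "c \<in> coords R k" "v = lcomb M c f k"
    unfolding lspan_def by auto
  then have "a \<odot>\<^bsub>M\<^esub> v = lcomb M (\<lambda>i. a \<otimes> c i) f k"
    using lcomb_smult[OF coords_Pi a f] by simp
  moreover have "(\<lambda>i. a \<otimes> c i) \<in> {..<k} \<rightarrow> carrier R" using c(1) a by auto
  ultimately show "a \<odot>\<^bsub>M\<^esub> v \<in> lspan R M k f"
    using lspanI by simp
qed

lemma lspan_mem:
  assumes f: "f \<in> {..<k} \<rightarrow> carrier M" and j: "j < k"
  shows "f j \<in> lspan R M k f"
  using lspanI[of "\<lambda>i. if i = j then \<one> else \<zero>" k R M f] lcomb_unit[OF f j] by simp

end

section \<open>Counting independent tuples in a vector space\<close>

context vectorspace
begin

lemma frames_inj_on: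
  assumes "f \<in> frames K V k"
  shows "inj_on (\<lambda>c. lcomb V c f k) (coords K k)"
proof (rule inj_onI)
  fix c d assume c: "c \<in> coords K k" and d: "d \<in> coords K k" and eq: "lcomb V c f k = lcomb V d f k"
  have f: "f \<in> {..<k} \<rightarrow> carrier V" using assms unfolding frames_def by auto
  \<comment> \<open>The difference of \<open>c\<close> and \<open>d\<close>, written with the scalar
    \<open>-1\<close> so that additivity and homogeneity of \<open>lcomb\<close> apply.\<close>
  define e where "e = (\<lambda>i\<in>{..<k}. c i \<oplus>\<^bsub>K\<^esub> (\<ominus>\<^bsub>K\<^esub> \<one>\<^bsub>K\<^esub>) \<otimes>\<^bsub>K\<^esub> d i)"
  have e: "e \<in> coords K k" unfolding e_def using c d by auto
  have d': "(\<lambda>i. (\<ominus>\<^bsub>K\<^esub> \<one>\<^bsub>K\<^esub>) \<otimes>\<^bsub>K\<^esub> d i) \<in> {..<k} \<rightarrow> carrier K" using d by auto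
  have "lcomb V e f k = lcomb V c f k \<oplus>\<^bsub>V\<^esub> lcomb V (\<lambda>i. (\<ominus>\<^bsub>K\<^esub> \<one>\<^bsub>K\<^esub>) \<otimes>\<^bsub>K\<^esub> d i) f k"
    unfolding e_def lcomb_restrict using c by (intro lcomb_add d' f) auto
  also have "lcomb V (\<lambda>i. (\<ominus>\<^bsub>K\<^esub> \<one>\<^bsub>K\<^esub>) \<otimes>\<^bsub>K\<^esub> d i) f k = (\<ominus>\<^bsub>K\<^esub> \<one>\<^bsub>K\<^esub>) \<odot>\<^bsub>V\<^esub> lcomb V d f k"
    using d f by (intro lcomb_smult) auto
  also have "lcomb V c f k \<oplus>\<^bsub>V\<^esub> (\<ominus>\<^bsub>K\<^esub> \<one>\<^bsub>K\<^esub>) \<odot>\<^bsub>V\<^esub> lcomb V d f k = \<zero>\<^bsub>V\<^esub>"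
    using lcomb_closed[OF coords_Pi[OF d] f] unfolding eq
    by (simp add: smult_l_minus M.r_neg)
  finally have z: "e i = \<zero>\<^bsub>K\<^esub>" if "i < k" for i
    using framesD[OF assms e] that by blast
  show "c = d"
  proof (rule PiE_ext[OF c d])
    fix i assume i: "i \<in> {..<k}"
    have ci: "c i \<in> carrier K" "d i \<in> carrier K" using c d i by auto
    then have "c i \<ominus>\<^bsub>K\<^esub> d i = \<zero>\<^bsub>K\<^esub>"
      using z[of i] i unfolding e_def by (simp add: R.l_minus a_minus_def)
    then show "c i = d i" using ci by simp
  qed
qed

lemma card_lspan:
  assumes "f \<in> frames K V k"
  shows "card (lspan K V k f) = card (carrier K) ^ k"
  unfolding lspan_def by (simp add: card_image[OF frames_inj_on[OF assms]] card_PiE)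

text \<open>A relation with nonzero coefficient at \<open>v\<close> can be divided by it and puts
  \<open>v\<close> into the span of \<open>f\<close>. Conversely, a representation of
  \<open>v\<close> in that span is a relation with coefficient \<open>-1\<close> at
  \<open>v\<close>.\<close>

lemma frames_Suc_iff:
  assumes f: "f \<in> {..<k} \<rightarrow>\<^sub>E carrier V" and v: "v \<in> carrier V"
  shows "f(k := v) \<in> frames K V (Suc k) \<longleftrightarrow> f \<in> frames K V k \<and> v \<notin> lspan K V k f"
proof -
  have f': "f \<in> {..<k} \<rightarrow> carrier V" using f by auto
  have fv: "f(k := v) \<in> {..<Suc k} \<rightarrow>\<^sub>E carrier V" using f v by (auto simp: PiE_iff extensional_def)
  have split: "lcomb V c (f(k := v)) (Suc k) = lcomb V c f k \<oplus>\<^bsub>V\<^esub> c k \<odot>\<^bsub>V\<^esub> v" for c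
    by (auto intro!: arg_cong2[where f = "add V"] lcomb_cong)
  show ?thesis
  proof safe
    assume F: "f(k := v) \<in> frames K V (Suc k)"
    show "f \<in> frames K V k"
      unfolding frames_def
    proof (safe intro!: f)
      fix c i assume c: "c \<in> coords K k" and z: "lcomb V c f k = \<zero>\<^bsub>V\<^esub>" and i: "i < k"
      let ?c = "c(k := \<zero>\<^bsub>K\<^esub>)"
      have "lcomb V ?c (f(k := v)) (Suc k) = \<zero>\<^bsub>V\<^esub>"
        unfolding split using z lcomb_cong[of k ?c c f f V] v by auto
      moreover have "?c \<in> coords K (Suc k)" using c by (auto simp: PiE_iff extensional_def)
      ultimately have "?c i = \<zero>\<^bsub>K\<^esub>" using framesD[OF F] i by (metis less_SucI)
      then show "c i = \<zero>\<^bsub>K\<^esub>" using i by simp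
    qed
    assume "v \<in> lspan K V k f"
    then obtain c where c: "c \<in> coords K k" "v = lcomb V c f k" unfolding lspan_def by auto
    let ?c = "c(k := \<ominus>\<^bsub>K\<^esub> \<one>\<^bsub>K\<^esub>)"
    have "lcomb V ?c f k = v" unfolding c(2) by (intro lcomb_cong) auto
    then have "lcomb V ?c (f(k := v)) (Suc k) = \<zero>\<^bsub>V\<^esub>"
      unfolding split using v by (simp add: smult_l_minus M.r_neg)
    moreover have "?c \<in> coords K (Suc k)" using c by (auto simp: PiE_iff extensional_def)
    ultimately have "?c k = \<zero>\<^bsub>K\<^esub>" using framesD[OF F] by blast
    then show False by simp
  next
    assume F: "f \<in> frames K V k" and vn: "v \<notin> lspan K V k f"
    show "f(k := v) \<in> frames K V (Suc k)"
      unfolding frames_def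
    proof (safe intro!: fv)
      fix c i assume c: "c \<in> coords K (Suc k)" and z: "lcomb V c (f(k := v)) (Suc k) = \<zero>\<^bsub>V\<^esub>"
        and i: "i < Suc k"
      have ck: "c k \<in> carrier K" and c': "c \<in> {..<k} \<rightarrow> carrier K" using c by (auto simp: PiE_iff)
      have sub: "submodule K (lspan K V k f) V" using submodule_lspan[OF f'] .
      let ?w = "lcomb V c f k"
      have w: "?w \<in> lspan K V k f" "?w \<in> carrier V"
        using lcomb_closed[OF c' f'] lspanI[OF c'] by auto
      have c0: "c k = \<zero>\<^bsub>K\<^esub>"
      proof (rule ccontr)
        assume nz: "c k \<noteq> \<zero>\<^bsub>K\<^esub>"
        then have u: "c k \<in> Units K" using ck field_Units by auto
        have "c k \<odot>\<^bsub>V\<^esub> v = \<ominus>\<^bsub>V\<^esub> ?w"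
          using z v ck w unfolding split by (metis M.minus_equality M.a_comm smult_closed)
        then have "v = (inv\<^bsub>K\<^esub> (c k)) \<odot>\<^bsub>V\<^esub> (\<ominus>\<^bsub>V\<^esub> ?w)"
          using u v ck by (metis R.Units_inv_closed R.Units_l_inv smult_assoc1 smult_one)
        also have "\<ominus>\<^bsub>V\<^esub> ?w = (\<ominus>\<^bsub>K\<^esub> \<one>\<^bsub>K\<^esub>) \<odot>\<^bsub>V\<^esub> ?w" using w by (simp add: smult_l_minus)
        finally have "v \<in> lspan K V k f"
          using w u by (auto intro!: submodule.smult_closed[OF sub])
        then show False using vn by simp
      qed
      then have "?w = \<zero>\<^bsub>V\<^esub>" using z w v unfolding split by simp
      moreover have "restrict c {..<k} \<in> coords K k" using c' by auto
      ultimately have "restrict c {..<k} i = \<zero>\<^bsub>K\<^esub>" if "i < k"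
        using framesD[OF F] that by (metis lcomb_restrict(1))
      then show "c i = \<zero>\<^bsub>K\<^esub>" using i c0 by (cases "i = k") auto
    qed
  qed
qed

lemma frames_Suc_eq:
  "frames K V (Suc k) = (\<lambda>(f, v). f(k := v)) ` (SIGMA f:frames K V k. carrier V - lspan K V k f)"
proof (intro subset_antisym subsetI)
  fix g assume g: "g \<in> frames K V (Suc k)"
  let ?f = "restrict g {..<k}"
  have gc: "g \<in> {..<Suc k} \<rightarrow>\<^sub>E carrier V" using g unfolding frames_def by auto
  have eq: "?f(k := g k) = g"
    using gc by (auto simp: fun_eq_iff PiE_iff extensional_def less_Suc_eq)
  have "?f \<in> {..<k} \<rightarrow>\<^sub>E carrier V" "g k \<in> carrier V" using gc by (auto simp: PiE_iff)
  with frames_Suc_iff[of ?f k "g k"] g eq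
  show "g \<in> (\<lambda>(f, v). f(k := v)) ` (SIGMA f:frames K V k. carrier V - lspan K V k f)"
    by (intro image_eqI[of _ _ "(?f, g k)"]) auto
next
  fix g assume "g \<in> (\<lambda>(f, v). f(k := v)) ` (SIGMA f:frames K V k. carrier V - lspan K V k f)"
  then obtain f v where fv: "f \<in> frames K V k" "v \<in> carrier V" "v \<notin> lspan K V k f" "g = f(k := v)"
    by auto
  moreover have "f \<in> {..<k} \<rightarrow>\<^sub>E carrier V" using fv unfolding frames_def by auto
  ultimately show "g \<in> frames K V (Suc k)" using frames_Suc_iff[of f k v] by simp
qed

lemma finite_frames:
  assumes "finite (carrier V)"
  shows "finite (frames K V k)"
  by (rule finite_subset[of _ "{..<k} \<rightarrow>\<^sub>E carrier V"])
    (use assms in \<open>auto simp: frames_def intro!: finite_PiE\<close>)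

text \<open>Once \<open>j\<close> independent vectors are chosen, the next one must avoid their
  span, which has \<open>|K|^j\<close> elements. When \<open>k\<close> exceeds the dimension, the
  product contains the factor zero, in agreement with the absence of frames.\<close>

lemma card_frames:
  assumes "finite (carrier V)"
  shows "card (frames K V k) = (\<Prod>j<k. card (carrier V) - card (carrier K) ^ j)"
proof (induction k)
  case 0
  have "frames K V 0 = {\<lambda>_. undefined}" unfolding frames_def by auto
  then show ?case by simp
next
  case (Suc k)
  have inj: "inj_on (\<lambda>(f, v). f(k := v)) (SIGMA f:frames K V k. carrier V - lspan K V k f)"
  proof (rule inj_onI, clarsimp)
    fix f v g w assume fg: "f \<in> frames K V k" "g \<in> frames K V k" and eq: "f(k := v) = g(k := w)"
    have "f k = g k" using fg unfolding frames_def by (auto simp: PiE_iff extensional_def)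
    then show "f = g \<and> v = w" using eq by (metis fun_upd_same fun_upd_triv fun_upd_upd)
  qed
  have "card (carrier V - lspan K V k f) = card (carrier V) - card (carrier K) ^ k"
    if f: "f \<in> frames K V k" for f
  proof -
    have "lspan K V k f \<subseteq> carrier V"
      using submodule.subset[OF submodule_lspan] f unfolding frames_def by blast
    then show ?thesis using card_lspan[OF f] assms
      by (metis card_Diff_subset finite_subset)
  qed
  then show ?case
    unfolding frames_Suc_eq card_image[OF inj]
    using Suc assms finite_frames[OF assms] by (subst card_SigmaI) (auto simp: mult.commute)
qed

text \<open>Coordinates with respect to a basis give a bijection with \<open>|K|^dim\<close> tuples.
  Below, dimensions are handled through cardinalities by means of this formula.\<close>

lemma card_eq_power_dim:
  assumes fin: "finite (carrier V)"
  shows "card (carrier V) = card (carrier K) ^ dim"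
proof -
  have "fin_dim"
    unfolding fin_dim_def using fin in_own_span[of "carrier V"] span_is_subset2[of "carrier V"]
    by (intro exI[of _ "carrier V"]) auto
  then obtain B where B: "finite B" "basis B" using finite_basis_exists by blast
  have BV: "B \<subseteq> carrier V" using B unfolding basis_def by auto
  have ex1: "\<exists>!a. a \<in> B \<rightarrow>\<^sub>E carrier K \<and> lincomb a B = v" if "v \<in> carrier V" for v
    using basis_criterion[OF B(1) BV] B(2) that by blast
  have "bij_betw (\<lambda>a. lincomb a B) (B \<rightarrow>\<^sub>E carrier K) (carrier V)"
    unfolding bij_betw_def
  proof
    have cl: "lincomb a B \<in> carrier V" if "a \<in> B \<rightarrow>\<^sub>E carrier K" for a
      using BV that by (intro lincomb_closed) auto
    show "inj_on (\<lambda>a. lincomb a B) (B \<rightarrow>\<^sub>E carrier K)"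
      using ex1 cl by (intro inj_onI) metis
    show "(\<lambda>a. lincomb a B) ` (B \<rightarrow>\<^sub>E carrier K) = carrier V"
      using ex1 cl by blast
  qed
  then have "card (carrier V) = card (B \<rightarrow>\<^sub>E carrier K)" by (simp add: bij_betw_same_card)
  then show ?thesis using B dim_basis by (simp add: card_PiE)
qed

end

section \<open>Dimension, spans and bases in finite vector spaces\<close>

locale finite_vectorspace = vectorspace +
  assumes finite_scalars: "finite (carrier K)" and finite_vectors: "finite (carrier V)"
begin

lemma card_scalars_ge_2: "2 \<le> card (carrier K)"
  using card_mono[OF finite_scalars, of "{\<zero>\<^bsub>K\<^esub>, \<one>\<^bsub>K\<^esub>}"] R.zero_closed by auto

lemma dim_eq_iff: "dim = k \<longleftrightarrow> card (carrier V) = card (carrier K) ^ k"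
  using card_eq_power_dim[OF finite_vectors] card_scalars_ge_2 by (auto simp: power_inject_exp)

lemma lspan_frame_eq:
  assumes "f \<in> frames K V k" "card (carrier V) = card (carrier K) ^ k"
  shows "lspan K V k f = carrier V"
proof -
  have "lspan K V k f \<subseteq> carrier V"
    using submodule.subset[OF submodule_lspan] assms(1) unfolding frames_def by blast
  then show ?thesis
    using card_lspan[OF assms(1)] assms(2) finite_vectors by (intro card_subset_eq) auto
qed

text \<open>Existence by counting: every factor \<open>|K|^k - |K|^j\<close> with
  \<open>j < k\<close> in the number of frames is positive.\<close>

lemma frame_exists:
  assumes "card (carrier V) = card (carrier K) ^ k"
  shows "frames K V k \<noteq> {}"
proof -
  have "card (carrier K) ^ j < card (carrier K) ^ k" if "j < k" for j
    using that card_scalars_ge_2 by (intro power_strict_increasing) auto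
  then have "card (frames K V k) > 0"
    unfolding card_frames[OF finite_vectors] assms by (intro prod_pos) auto
  then show ?thesis by auto
qed

lemma finite_subspace:
  assumes "subspace K C V"
  shows "finite_vectorspace K (V\<lparr>carrier := C\<rparr>)"
proof -
  have "C \<subseteq> carrier V" using assms unfolding subspace_def submodule_def by auto
  then show ?thesis
    using subspace_is_vs[OF assms] finite_scalars finite_vectors
    by (auto simp: finite_vectorspace_def finite_vectorspace_axioms_def intro: finite_subset)
qed

end

section \<open>Full-rank matrices\<close>

lemma mat_in_mats_iff: "mat a m F \<in> mats K a m \<longleftrightarrow> (\<forall>i<a. \<forall>j<m. F (i, j) \<in> carrier K)"
  unfolding mats_def by auto

lemma mats_eqI:
  assumes "A \<in> mats K a m" "B \<in> mats K a m" "\<And>i j. i < a \<Longrightarrow> j < m \<Longrightarrow> A $$ (i, j) = B $$ (i, j)"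
  shows "A = B"
  using assms unfolding mats_def by (intro eq_matI) auto

lemma finite_mats:
  assumes "finite (carrier K)"
  shows "finite (mats K a m)"
proof (rule inj_on_finite)
  show "inj_on (\<lambda>A. \<lambda>ij\<in>{..<a} \<times> {..<m}. A $$ ij) (mats K a m)"
  proof (rule inj_onI)
    fix A B assume AB: "A \<in> mats K a m" "B \<in> mats K a m"
      and eq: "(\<lambda>ij\<in>{..<a} \<times> {..<m}. A $$ ij) = (\<lambda>ij\<in>{..<a} \<times> {..<m}. B $$ ij)"
    show "A = B"
    proof (rule mats_eqI[OF AB])
      fix i j assume "i < a" "j < m"
      then show "A $$ (i, j) = B $$ (i, j)" using fun_cong[OF eq, of "(i, j)"] by simp
    qed
  qed
  show "(\<lambda>A. \<lambda>ij\<in>{..<a} \<times> {..<m}. A $$ ij) ` mats K a m \<subseteq> ({..<a} \<times> {..<m}) \<rightarrow>\<^sub>E carrier K"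
    unfolding image_subset_iff restrict_PiE_iff by (simp add: mats_def)
  show "finite (({..<a} \<times> {..<m}) \<rightarrow>\<^sub>E carrier K)"
    using assms by (intro finite_PiE) auto
qed

lemma vec_module_simps [simp]:
  "carrier (vec_module K a) = {v \<in> carrier_vec a. \<forall>i<a. v $ i \<in> carrier K}"
  "zero (vec_module K a) = vec a (\<lambda>i. \<zero>\<^bsub>K\<^esub>)"
  "add (vec_module K a) v w = vec a (\<lambda>i. v $ i \<oplus>\<^bsub>K\<^esub> w $ i)"
  "smult (vec_module K a) c v = vec a (\<lambda>i. c \<otimes>\<^bsub>K\<^esub> v $ i)"
  unfolding vec_module_def by auto

lemma mat_module_simps [simp]:
  "carrier (mat_module K a m) = mats K a m"
  "zero (mat_module K a m) = mat a m (\<lambda>ij. \<zero>\<^bsub>K\<^esub>)"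
  "add (mat_module K a m) A B = mat a m (\<lambda>ij. A $$ ij \<oplus>\<^bsub>K\<^esub> B $$ ij)"
  "smult (mat_module K a m) c A = mat a m (\<lambda>ij. c \<otimes>\<^bsub>K\<^esub> A $$ ij)"
  unfolding mat_module_def by auto

lemma card_vec_module: "card (carrier (vec_module K a)) = card (carrier K) ^ a"
proof -
  have "bij_betw (\<lambda>c. vec a c) (coords K a) (carrier (vec_module K a))"
  proof (rule bij_betw_byWitness[where f' = "\<lambda>v. restrict (($) v) {..<a}"])
    show "\<forall>c\<in>coords K a. restrict (($) (vec a c)) {..<a} = c"
    proof
      fix c assume c: "c \<in> coords K a"
      show "restrict (($) (vec a c)) {..<a} = c"
      proof
        fix i
        show "restrict (($) (vec a c)) {..<a} i = c i"
          using PiE_arb[OF c, of i] by (cases "i < a") simp_all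
      qed
    qed
    show "\<forall>v\<in>carrier (vec_module K a). vec a (restrict (($) v) {..<a}) = v"
      by (intro ballI eq_vecI) auto
    show "vec a ` coords K a \<subseteq> carrier (vec_module K a)"
      by (simp add: image_subset_iff PiE_iff)
    show "(\<lambda>v. restrict (($) v) {..<a}) ` carrier (vec_module K a) \<subseteq> coords K a"
      unfolding image_subset_iff restrict_PiE_iff by simp
  qed
  from bij_betw_same_card[OF this] show ?thesis by (simp add: card_PiE)
qed

section \<open>Vectors, functionals and ranks over a finite field\<close>

locale finite_field = field K for K (structure) +
  assumes finite_carrier: "finite (carrier K)"
begin

lemma card_ge_2: "2 \<le> card (carrier K)"
  using card_mono[OF finite_carrier, of "{\<zero>, \<one>}"] by auto

lemma finite_vectorspace_vec: "finite_vectorspace K (vec_module K a)"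
proof -
  have "module K (vec_module K a)"
  proof (rule module_criteria)
    show "\<forall>v\<in>carrier (vec_module K a). \<exists>w\<in>carrier (vec_module K a).
        v \<oplus>\<^bsub>vec_module K a\<^esub> w = \<zero>\<^bsub>vec_module K a\<^esub>"
    proof
      fix v assume "v \<in> carrier (vec_module K a)"
      then show "\<exists>w\<in>carrier (vec_module K a). v \<oplus>\<^bsub>vec_module K a\<^esub> w = \<zero>\<^bsub>vec_module K a\<^esub>"
        by (intro bexI[of _ "vec a (\<lambda>i. \<ominus> (v $ i))"]) (auto intro!: eq_vecI simp: r_neg)
    qed
  qed (auto intro!: eq_vecI is_cring simp: a_ac m_assoc l_distr r_distr)
  moreover have "finite (carrier (vec_module K a))"
    using card_vec_module[of K a] card_ge_2 by (intro card_ge_0_finite) auto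
  ultimately show ?thesis
    using field_axioms finite_carrier
    by (auto simp: finite_vectorspace_def finite_vectorspace_axioms_def vectorspace_def)
qed

lemma finite_vectorspace_mat: "finite_vectorspace K (mat_module K a m)"
proof -
  have "module K (mat_module K a m)"
  proof (rule module_criteria)
    show "\<forall>v\<in>carrier (mat_module K a m). \<exists>w\<in>carrier (mat_module K a m).
        v \<oplus>\<^bsub>mat_module K a m\<^esub> w = \<zero>\<^bsub>mat_module K a m\<^esub>"
    proof
      fix v assume "v \<in> carrier (mat_module K a m)"
      then show "\<exists>w\<in>carrier (mat_module K a m). v \<oplus>\<^bsub>mat_module K a m\<^esub> w = \<zero>\<^bsub>mat_module K a m\<^esub>"
        by (intro bexI[of _ "mat a m (\<lambda>ij. \<ominus> (v $$ ij))"])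
          (auto intro!: eq_matI simp: r_neg mats_def)
    qed
  qed (auto intro!: eq_matI is_cring simp: a_ac m_assoc l_distr r_distr mats_def)
  then show ?thesis
    using field_axioms finite_carrier finite_mats[OF finite_carrier]
    by (auto simp: finite_vectorspace_def finite_vectorspace_axioms_def vectorspace_def)
qed

lemma lcomb_vec_index:
  assumes "c \<in> {..<k} \<rightarrow> carrier K" "f \<in> {..<k} \<rightarrow> carrier (vec_module K a)" "i < a"
  shows "lcomb (vec_module K a) c f k $ i = (\<Oplus>l\<in>{..<k}. c l \<otimes> f l $ i)"
  using assms by (induction k) (auto simp: finsum_lessThan_Suc Pi_iff)

lemma lcomb_mat_index:
  assumes "c \<in> {..<k} \<rightarrow> carrier K" "f \<in> {..<k} \<rightarrow> mats K a m" "i < a" "j < m"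
  shows "lcomb (mat_module K a m) c f k $$ (i, j) = (\<Oplus>l\<in>{..<k}. c l \<otimes> f l $$ (i, j))"
  using assms by (induction k) (auto simp: finsum_lessThan_Suc Pi_iff mats_def)

text \<open>This set is the kernel of the functional with coordinates \<open>x\<close>. Being a
  submodule, it contains the column space of a matrix as soon as it contains the columns.\<close>

lemma submodule_annihilator:
  assumes x: "x \<in> coords K a"
  shows "submodule K {w \<in> carrier (vec_module K a). (\<Oplus>i\<in>{..<a}. x i \<otimes> w $ i) = \<zero>} (vec_module K a)"
proof -
  interpret V: finite_vectorspace K "vec_module K a" by (rule finite_vectorspace_vec)
  have x': "x i \<in> carrier K" if "i < a" for i using x that by auto
  show ?thesis
  proof
    show "\<zero>\<^bsub>vec_module K a\<^esub> \<in> {w \<in> carrier (vec_module K a). (\<Oplus>i\<in>{..<a}. x i \<otimes> w $ i) = \<zero>}"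
    proof -
      have "(\<Oplus>i\<in>{..<a}. x i \<otimes> vec a (\<lambda>i. \<zero>) $ i) = \<zero>"
        using x' by (intro finsum_all0) auto
      then show ?thesis by simp
    qed
  next
    fix v w
    assume v: "v \<in> {w \<in> carrier (vec_module K a). (\<Oplus>i\<in>{..<a}. x i \<otimes> w $ i) = \<zero>}"
      and w: "w \<in> {w \<in> carrier (vec_module K a). (\<Oplus>i\<in>{..<a}. x i \<otimes> w $ i) = \<zero>}"
    have "(\<Oplus>i\<in>{..<a}. x i \<otimes> vec a (\<lambda>i. v $ i \<oplus> w $ i) $ i)
        = (\<Oplus>i\<in>{..<a}. x i \<otimes> v $ i \<oplus> x i \<otimes> w $ i)"
      using x' v w by (intro finsum_cong') (auto simp: r_distr)
    also have "\<dots> = (\<Oplus>i\<in>{..<a}. x i \<otimes> v $ i) \<oplus> (\<Oplus>i\<in>{..<a}. x i \<otimes> w $ i)"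
      using x' v w by (intro finsum_addf) auto
    finally show "v \<oplus>\<^bsub>vec_module K a\<^esub> w
        \<in> {w \<in> carrier (vec_module K a). (\<Oplus>i\<in>{..<a}. x i \<otimes> w $ i) = \<zero>}"
      using v w by auto
  next
    fix c v
    assume c: "c \<in> carrier K"
      and v: "v \<in> {w \<in> carrier (vec_module K a). (\<Oplus>i\<in>{..<a}. x i \<otimes> w $ i) = \<zero>}"
    have "(\<Oplus>i\<in>{..<a}. x i \<otimes> vec a (\<lambda>i. c \<otimes> v $ i) $ i) = (\<Oplus>i\<in>{..<a}. c \<otimes> (x i \<otimes> v $ i))"
      using x' v c by (intro finsum_cong') (auto simp: m_lcomm)
    also have "\<dots> = c \<otimes> (\<Oplus>i\<in>{..<a}. x i \<otimes> v $ i)"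
      using x' v c by (intro finsum_rdistr[symmetric]) auto
    finally show "c \<odot>\<^bsub>vec_module K a\<^esub> v
        \<in> {w \<in> carrier (vec_module K a). (\<Oplus>i\<in>{..<a}. x i \<otimes> w $ i) = \<zero>}"
      using v c by auto
  qed (auto intro: V.module_axioms)
qed

lemma annihilator_eq_carrier:
  assumes x: "x \<in> coords K a"
    and eq: "carrier (vec_module K a) \<subseteq> {w \<in> carrier (vec_module K a). (\<Oplus>i\<in>{..<a}. x i \<otimes> w $ i) = \<zero>}"
    and i: "i < a"
  shows "x i = \<zero>"
proof -
  have x': "x i \<in> carrier K" if "i < a" for i using x that by auto
  let ?e = "vec a (\<lambda>l. if l = i then \<one> else \<zero>)"
  have "?e \<in> carrier (vec_module K a)" by auto
  then have "(\<Oplus>l\<in>{..<a}. x l \<otimes> ?e $ l) = \<zero>" using eq by blast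
  also have "(\<Oplus>l\<in>{..<a}. x l \<otimes> ?e $ l) = (\<Oplus>l\<in>{..<a}. if i = l then x l else \<zero>)"
    using x' by (intro finsum_cong') auto
  also have "\<dots> = x i"
    using i x' by (intro add.finprod_singleton) auto
  finally show ?thesis .
qed

text \<open>By the pigeonhole principle two distinct functionals agree on a basis of \<open>W\<close>; take their difference.\<close>

lemma exists_annihilator:
  assumes W: "subspace K W (vec_module K a)" and card: "card W = card (carrier K) ^ d" and d: "d < a"
  shows "\<exists>x\<in>coords K a. (\<exists>i<a. x i \<noteq> \<zero>) \<and> (\<forall>w\<in>W. (\<Oplus>i\<in>{..<a}. x i \<otimes> w $ i) = \<zero>)"
proof -
  interpret V: finite_vectorspace K "vec_module K a" by (rule finite_vectorspace_vec)
  interpret W: finite_vectorspace K "vec_module K a\<lparr>carrier := W\<rparr>"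
    by (rule V.finite_subspace[OF W])
  have WV: "W \<subseteq> carrier (vec_module K a)" using W unfolding subspace_def submodule_def by auto
  obtain f where f: "f \<in> frames K (vec_module K a\<lparr>carrier := W\<rparr>) d"
    using W.frame_exists[of d] card by auto
  have f_in: "f l \<in> W" if "l < d" for l using f that unfolding frames_def by auto
  then have fV: "f l \<in> carrier (vec_module K a)" if "l < d" for l using that WV by blast
  define \<phi> where "\<phi> x = (\<lambda>l\<in>{..<d}. \<Oplus>i\<in>{..<a}. x i \<otimes> f l $ i)" for x
  have \<phi>: "\<phi> ` coords K a \<subseteq> coords K d"
    unfolding \<phi>_def using fV by (auto simp: PiE_iff Pi_iff intro!: finsum_closed)
  have "\<not> inj_on \<phi> (coords K a)"
  proof
    assume "inj_on \<phi> (coords K a)"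
    then have "card (coords K a) \<le> card (coords K d)"
      using \<phi> finite_carrier by (intro card_inj_on_le) (auto intro!: finite_PiE)
    then have "card (carrier K) ^ a \<le> card (carrier K) ^ d" by (simp add: card_PiE)
    moreover have "card (carrier K) ^ d < card (carrier K) ^ a"
      using d card_ge_2 by (intro power_strict_increasing) auto
    ultimately show False by simp
  qed
  then obtain x y where x: "x \<in> coords K a" and y: "y \<in> coords K a" and xy: "x \<noteq> y" "\<phi> x = \<phi> y"
    unfolding inj_on_def by blast
  define z where "z = (\<lambda>i\<in>{..<a}. x i \<ominus> y i)"
  have z: "z \<in> coords K a" unfolding z_def using x y by auto
  have nz: "\<exists>i<a. z i \<noteq> \<zero>"
  proof (rule ccontr)
    assume "\<not> ?thesis"
    then have "x i = y i" if "i < a" for i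
      using that x y unfolding z_def by (force simp: PiE_iff)
    then have "x = y" by (intro PiE_ext[OF x y]) auto
    then show False using xy by simp
  qed
  let ?N = "{w \<in> carrier (vec_module K a). (\<Oplus>i\<in>{..<a}. z i \<otimes> w $ i) = \<zero>}"
  have "f l \<in> ?N" if l: "l < d" for l
  proof -
    have xyf: "x i \<in> carrier K" "y i \<in> carrier K" "f l $ i \<in> carrier K" if "i < a" for i
      using x y fV[OF l] that by auto
    have "(\<Oplus>i\<in>{..<a}. z i \<otimes> f l $ i) = (\<Oplus>i\<in>{..<a}. x i \<otimes> f l $ i \<ominus> y i \<otimes> f l $ i)"
      unfolding z_def using xyf by (intro finsum_cong') (auto simp: l_distr a_minus_def l_minus)
    also have "\<dots> = (\<Oplus>i\<in>{..<a}. x i \<otimes> f l $ i) \<oplus> (\<Oplus>i\<in>{..<a}. \<ominus> (y i \<otimes> f l $ i))"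
      unfolding a_minus_def using xyf by (intro finsum_addf) auto
    also have "(\<Oplus>i\<in>{..<a}. \<ominus> (y i \<otimes> f l $ i)) = (\<Oplus>i\<in>{..<a}. (\<ominus> \<one>) \<otimes> (y i \<otimes> f l $ i))"
      using xyf by (intro finsum_cong') (auto simp: l_minus)
    also have "\<dots> = (\<ominus> \<one>) \<otimes> (\<Oplus>i\<in>{..<a}. y i \<otimes> f l $ i)"
      using xyf by (intro finsum_rdistr[symmetric]) auto
    also have "(\<Oplus>i\<in>{..<a}. y i \<otimes> f l $ i) = (\<Oplus>i\<in>{..<a}. x i \<otimes> f l $ i)"
      using fun_cong[OF xy(2), of l] l unfolding \<phi>_def by simp
    also have "(\<Oplus>i\<in>{..<a}. x i \<otimes> f l $ i) \<oplus> (\<ominus> \<one>) \<otimes> (\<Oplus>i\<in>{..<a}. x i \<otimes> f l $ i) = \<zero>"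
      using xyf by (simp add: l_minus r_neg Pi_iff)
    finally show ?thesis using fV[OF l] by simp
  qed
  then have "lspan K (vec_module K a) d f \<subseteq> ?N"
    by (intro V.lspan_subset submodule_annihilator[OF z]) auto
  moreover have "lspan K (vec_module K a) d f = W"
    using W.lspan_frame_eq[OF f] card by (simp add: lspan_def)
  ultimately show ?thesis using z nz by blast
qed

text \<open>Full rank is rephrased as linear independence of the rows. A functional vanishing on all
  columns vanishes on the column space \<open>?W\<close>; this forces \<open>x = \<zero>\<close>
  when \<open>?W\<close> is everything, while a proper subspace always has a nonzero functional
  vanishing on it.\<close>

lemma full_rank_iff:
  assumes A: "A \<in> mats K a m"
  shows "a \<le> mat_rank K A \<longleftrightarrow>
    (\<forall>x\<in>coords K a. (\<forall>j<m. (\<Oplus>i\<in>{..<a}. x i \<otimes> A $$ (i, j)) = \<zero>) \<longrightarrow> (\<forall>i<a. x i = \<zero>))"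
proof -
  let ?V = "vec_module K a"
  interpret V: finite_vectorspace K ?V by (rule finite_vectorspace_vec)
  have dims: "dim_row A = a" "dim_col A = m" using A unfolding mats_def by auto
  let ?S = "set (cols A)"
  have S_eq: "?S = (\<lambda>j. col A j) ` {..<m}" unfolding cols_def dims by auto
  have S: "?S \<subseteq> carrier ?V"
  proof
    fix v assume "v \<in> ?S"
    then obtain j where "j < m" "v = col A j" unfolding S_eq by auto
    then show "v \<in> carrier ?V" using dims A by (simp add: mats_def)
  qed
  let ?W = "V.span ?S"
  have W: "subspace K ?W ?V" by (rule V.span_is_subspace[OF S])
  interpret W: finite_vectorspace K "?V\<lparr>carrier := ?W\<rparr>"
    by (rule V.finite_subspace[OF W])
  have rank: "mat_rank K A = W.dim" unfolding mat_rank_def dims Let_def ..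
  have cardW: "card ?W = card (carrier K) ^ mat_rank K A"
    using W.card_eq_power_dim[OF W.finite_vectors] rank by simp
  have cols_ann: "(\<Oplus>i\<in>{..<a}. x i \<otimes> col A j $ i) = (\<Oplus>i\<in>{..<a}. x i \<otimes> A $$ (i, j))"
    if "x \<in> coords K a" "j < m" for x j
    using that A dims by (intro finsum_cong') (auto simp: Pi_iff PiE_iff mats_def)
  show ?thesis
  proof (intro iffI ballI impI allI)
    fix x i assume r: "a \<le> mat_rank K A" and x: "x \<in> coords K a"
      and z: "\<forall>j<m. (\<Oplus>i\<in>{..<a}. x i \<otimes> A $$ (i, j)) = \<zero>" and i: "i < a"
    let ?N = "{w \<in> carrier ?V. (\<Oplus>i\<in>{..<a}. x i \<otimes> w $ i) = \<zero>}"
    have "?S \<subseteq> ?N" using S z cols_ann[OF x] unfolding S_eq by auto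
    then have WN: "?W \<subseteq> ?N" by (intro V.span_is_subset submodule_annihilator[OF x])
    \<comment> \<open>The column space has \<open>|K|^rank\<close> elements, hence at least as many
      as the ambient space of column vectors.\<close>
    have "card (carrier ?V) \<le> card ?W"
      unfolding cardW card_vec_module using r card_ge_2 by (intro power_increasing) auto
    moreover have "?W \<subseteq> carrier ?V" using WN by blast
    ultimately have "?W = carrier ?V" using V.finite_vectors by (intro card_seteq) auto
    then show "x i = \<zero>" using annihilator_eq_carrier[OF x _ i] WN by simp
  next
    assume R: "\<forall>x\<in>coords K a. (\<forall>j<m. (\<Oplus>i\<in>{..<a}. x i \<otimes> A $$ (i, j)) = \<zero>) \<longrightarrow> (\<forall>i<a. x i = \<zero>)"
    show "a \<le> mat_rank K A"
    proof (rule ccontr)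
      assume "\<not> a \<le> mat_rank K A"
      then obtain x where x: "x \<in> coords K a" "\<exists>i<a. x i \<noteq> \<zero>"
        "\<forall>w\<in>?W. (\<Oplus>i\<in>{..<a}. x i \<otimes> w $ i) = \<zero>"
        using exists_annihilator[OF W cardW] by auto
      have "(\<Oplus>i\<in>{..<a}. x i \<otimes> A $$ (i, j)) = \<zero>" if "j < m" for j
        using x(3) V.in_own_span[OF S] cols_ann[OF x(1) that] that unfolding S_eq by fastforce
      then show False using R x by blast
    qed
  qed
qed

end

section \<open>Nonsingular tensors and rank-metric codes\<close>

text \<open>The tuple \<open>f\<close> stands for the tensor with entries \<open>t(l,i,j) = f l $$ (i, j)\<close>.\<close>

definition tensors :: "('a, 'b) ring_scheme \<Rightarrow> nat \<Rightarrow> nat \<Rightarrow> nat \<Rightarrow> (nat \<Rightarrow> 'a mat) set" where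
  "tensors K a m k = {f \<in> {..<k} \<rightarrow>\<^sub>E mats K a m.
     \<forall>c\<in>coords K k. \<forall>x\<in>coords K a. (\<exists>l<k. c l \<noteq> \<zero>\<^bsub>K\<^esub>) \<longrightarrow> (\<exists>i<a. x i \<noteq> \<zero>\<^bsub>K\<^esub>) \<longrightarrow>
       (\<exists>j<m. (\<Oplus>\<^bsub>K\<^esub>i\<in>{..<a}. x i \<otimes>\<^bsub>K\<^esub> (\<Oplus>\<^bsub>K\<^esub>l\<in>{..<k}. c l \<otimes>\<^bsub>K\<^esub> f l $$ (i, j))) \<noteq> \<zero>\<^bsub>K\<^esub>)}"

context finite_field
begin

text \<open>For fixed \<open>c\<close> the inner sums are the entries of the combination of the
  matrices \<open>f l\<close>, so the condition on \<open>x\<close> is the row criterion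
  \<open>full_rank_iff\<close> for that combination.\<close>

lemma tensors_iff:
  assumes f: "f \<in> {..<k} \<rightarrow>\<^sub>E mats K a m"
  shows "f \<in> tensors K a m k \<longleftrightarrow>
    (\<forall>c\<in>coords K k. (\<exists>l<k. c l \<noteq> \<zero>) \<longrightarrow> a \<le> mat_rank K (lcomb (mat_module K a m) c f k))"
proof -
  interpret M: finite_vectorspace K "mat_module K a m" by (rule finite_vectorspace_mat)
  have f': "f \<in> {..<k} \<rightarrow> mats K a m" using f by (simp add: PiE_iff)
  define Q where "Q c \<longleftrightarrow> (\<forall>x\<in>coords K a. (\<exists>i<a. x i \<noteq> \<zero>) \<longrightarrow>
          (\<exists>j<m. (\<Oplus>i\<in>{..<a}. x i \<otimes> (\<Oplus>l\<in>{..<k}. c l \<otimes> f l $$ (i, j))) \<noteq> \<zero>))" for c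
  have "Q c \<longleftrightarrow> a \<le> mat_rank K (lcomb (mat_module K a m) c f k)" if c: "c \<in> coords K k" for c
  proof -
    have L: "lcomb (mat_module K a m) c f k \<in> mats K a m"
      using M.lcomb_closed[OF coords_Pi[OF c]] f' by simp
    have eq: "(\<Oplus>i\<in>{..<a}. x i \<otimes> lcomb (mat_module K a m) c f k $$ (i, j))
        = (\<Oplus>i\<in>{..<a}. x i \<otimes> (\<Oplus>l\<in>{..<k}. c l \<otimes> f l $$ (i, j)))"
      if "x \<in> coords K a" "j < m" for x j
    proof (rule finsum_cong'[OF refl])
      show "(\<lambda>i. x i \<otimes> (\<Oplus>l\<in>{..<k}. c l \<otimes> f l $$ (i, j))) \<in> {..<a} \<rightarrow> carrier K"
        using that c f' by (auto simp: PiE_iff Pi_iff mats_def intro!: finsum_closed)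
    qed (use that lcomb_mat_index[OF coords_Pi[OF c] f'] in simp)
    show ?thesis unfolding full_rank_iff[OF L] Q_def using eq by force
  qed
  moreover have "f \<in> tensors K a m k \<longleftrightarrow> (\<forall>c\<in>coords K k. (\<exists>l<k. c l \<noteq> \<zero>) \<longrightarrow> Q c)"
    unfolding tensors_def mem_Collect_eq Q_def by (simp only: f simp_thms) blast
  ultimately show ?thesis by (simp cong: ball_cong)
qed

text \<open>Nonsingular tensors are partitioned according to the code that their matrices span. The
  class of a code \<open>C\<close> consists of the ordered bases of \<open>C\<close>, whose number
  depends only on \<open>k\<close>.\<close>

lemma card_tensors:
  assumes a: "1 \<le> a"
  shows "card (tensors K a m k)
    = card (rank_codes K a m k a) * (\<Prod>j<k. card (carrier K) ^ k - card (carrier K) ^ j)"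
proof -
  let ?M = "mat_module K a m"
  interpret M: finite_vectorspace K ?M by (rule finite_vectorspace_mat)
  let ?F = "\<lambda>C. frames K (?M\<lparr>carrier := C\<rparr>) k"
  have code: "subspace K C ?M" "C \<subseteq> mats K a m" "finite_vectorspace K (?M\<lparr>carrier := C\<rparr>)"
      "card C = card (carrier K) ^ k"
      "\<And>A. A \<in> C \<Longrightarrow> A \<noteq> \<zero>\<^bsub>?M\<^esub> \<Longrightarrow> a \<le> mat_rank K A"
    if "C \<in> rank_codes K a m k a" for C
  proof -
    show s: "subspace K C ?M" and "\<And>A. A \<in> C \<Longrightarrow> A \<noteq> \<zero>\<^bsub>?M\<^esub> \<Longrightarrow> a \<le> mat_rank K A"
      using that unfolding rank_codes_def by auto
    show "C \<subseteq> mats K a m" using s unfolding subspace_def submodule_def by auto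
    show f: "finite_vectorspace K (?M\<lparr>carrier := C\<rparr>)" by (rule M.finite_subspace[OF s])
    show "card C = card (carrier K) ^ k"
      using finite_vectorspace.dim_eq_iff[OF f, of k] that unfolding rank_codes_def by auto
  qed
  have finite_codes: "finite (rank_codes K a m k a)"
    by (rule finite_subset[of _ "Pow (mats K a m)"])
      (use code(2) finite_mats[OF finite_carrier] in auto)
  \<comment> \<open>Here \<open>1 \<le> a\<close> enters: the zero matrix lacks full rank, so a
    nontrivial combination in a nonsingular tensor cannot vanish and its matrices are linearly
    independent.\<close>
  have zero_rank: "\<not> a \<le> mat_rank K \<zero>\<^bsub>?M\<^esub>"
  proof -
    have Z: "\<zero>\<^bsub>?M\<^esub> \<in> mats K a m" using M.M.zero_closed by simp
    let ?x = "\<lambda>i\<in>{..<a}. \<one>"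
    have "(\<Oplus>i\<in>{..<a}. ?x i \<otimes> \<zero>\<^bsub>?M\<^esub> $$ (i, j)) = \<zero>" if "j < m" for j
      using that by (intro finsum_all0) simp_all
    moreover have "?x \<in> coords K a" "?x 0 \<noteq> \<zero>" using a by auto
    moreover have "0 < a" using a by simp
    ultimately show ?thesis unfolding full_rank_iff[OF Z] by blast
  qed
  have "tensors K a m k = (\<Union>C\<in>rank_codes K a m k a. ?F C)"
  proof (intro subset_antisym subsetI)
    fix f assume ft: "f \<in> tensors K a m k"
    then have f: "f \<in> {..<k} \<rightarrow>\<^sub>E mats K a m" unfolding tensors_def by blast
    then have f': "f \<in> {..<k} \<rightarrow> carrier ?M" by (simp add: PiE_iff)
    have rank: "a \<le> mat_rank K (lcomb ?M c f k)" if "c \<in> coords K k" "\<exists>l<k. c l \<noteq> \<zero>" for c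
      using ft that unfolding tensors_iff[OF f] by blast
    have fr: "f \<in> frames K ?M k"
      unfolding frames_def using f rank zero_rank by (simp, metis)
    define C where "C = lspan K ?M k f"
    have sub: "submodule K C ?M" unfolding C_def by (rule M.submodule_lspan[OF f'])
    then have S: "subspace K C ?M" unfolding subspace_def using M.vectorspace_axioms by blast
    interpret C: finite_vectorspace K "?M\<lparr>carrier := C\<rparr>" by (rule M.finite_subspace[OF S])
    have "C.dim = k" using M.card_lspan[OF fr] C.dim_eq_iff[of k] by (simp add: C_def)
    moreover have "a \<le> mat_rank K A" if A: "A \<in> C" "A \<noteq> \<zero>\<^bsub>?M\<^esub>" for A
    proof -
      obtain c where c: "c \<in> coords K k" "A = lcomb ?M c f k" using A(1) unfolding C_def lspan_def by blast
      have "\<exists>l<k. c l \<noteq> \<zero>" using M.lcomb_zero[OF f', of c] A(2) c(2) by blast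
      then show ?thesis using rank[OF c(1)] c(2) by simp
    qed
    ultimately have "C \<in> rank_codes K a m k a" unfolding rank_codes_def using S by blast
    moreover have "f \<in> ?F C"
      using fr M.lspan_mem[OF f'] unfolding frames_def C_def by (simp add: PiE_iff)
    ultimately show "f \<in> (\<Union>C\<in>rank_codes K a m k a. ?F C)" by blast
  next
    fix f assume "f \<in> (\<Union>C\<in>rank_codes K a m k a. ?F C)"
    then obtain C where C: "C \<in> rank_codes K a m k a" and f: "f \<in> ?F C" by blast
    interpret C: finite_vectorspace K "?M\<lparr>carrier := C\<rparr>" by (rule code(3)[OF C])
    have fC: "f \<in> {..<k} \<rightarrow>\<^sub>E C" using f unfolding frames_def by simp
    then have fm: "f \<in> {..<k} \<rightarrow>\<^sub>E mats K a m" using code(2)[OF C] by (auto simp: PiE_iff)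
    have "a \<le> mat_rank K (lcomb ?M c f k)" if c: "c \<in> coords K k" "\<exists>l<k. c l \<noteq> \<zero>" for c
    proof (rule code(5)[OF C])
      show "lcomb ?M c f k \<in> C"
        using C.lcomb_closed[OF coords_Pi[OF c(1)], of f] fC by (simp add: PiE_iff)
      show "lcomb ?M c f k \<noteq> \<zero>\<^bsub>?M\<^esub>"
        using framesD[OF f c(1)] c(2) by auto
    qed
    then show "f \<in> tensors K a m k" unfolding tensors_iff[OF fm] by blast
  qed
  also have "card \<dots> = (\<Sum>C\<in>rank_codes K a m k a. card (?F C))"
  proof (rule card_UN_disjoint[OF finite_codes])
    show "\<forall>C\<in>rank_codes K a m k a. finite (?F C)"
    proof
      fix C assume C: "C \<in> rank_codes K a m k a"
      interpret C: finite_vectorspace K "?M\<lparr>carrier := C\<rparr>" by (rule code(3)[OF C])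
      show "finite (?F C)" by (rule C.finite_frames[OF C.finite_vectors])
    qed
    \<comment> \<open>A basis determines its code as its span, and \<open>lspan\<close> is the same
      set whether formed in \<open>C\<close> or in the whole matrix space. So the classes are
      disjoint.\<close>
    have "lspan K ?M k f = C" if C: "C \<in> rank_codes K a m k a" and f: "f \<in> ?F C" for C f
      using finite_vectorspace.lspan_frame_eq[OF code(3)[OF C] f] code(4)[OF C]
      by (simp add: lspan_def)
    then show "\<forall>C\<in>rank_codes K a m k a. \<forall>D\<in>rank_codes K a m k a. C \<noteq> D \<longrightarrow> ?F C \<inter> ?F D = {}"
      by blast
  qed
  also have "\<dots> = (\<Sum>C\<in>rank_codes K a m k a. \<Prod>j<k. card (carrier K) ^ k - card (carrier K) ^ j)"
  proof (rule sum.cong[OF refl])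
    fix C assume C: "C \<in> rank_codes K a m k a"
    interpret C: finite_vectorspace K "?M\<lparr>carrier := C\<rparr>" by (rule code(3)[OF C])
    show "card (?F C) = (\<Prod>j<k. card (carrier K) ^ k - card (carrier K) ^ j)"
      using C.card_frames[OF C.finite_vectors, of k] code(4)[OF C] by simp
  qed
  finally show ?thesis by simp
qed

definition swap_tensor :: "nat \<Rightarrow> nat \<Rightarrow> nat \<Rightarrow> (nat \<Rightarrow> 'a mat) \<Rightarrow> nat \<Rightarrow> 'a mat" where
  "swap_tensor a m k f = (\<lambda>i\<in>{..<a}. mat k m (\<lambda>(l, j). f l $$ (i, j)))"

lemma swap_tensor_swap_tensor:
  assumes f: "f \<in> {..<k} \<rightarrow>\<^sub>E mats K a m"
  shows "swap_tensor k m a (swap_tensor a m k f) = f"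
proof
  fix l
  show "swap_tensor k m a (swap_tensor a m k f) l = f l"
  proof (cases "l < k")
    case True
    then have "f l \<in> mats K a m" using f by (simp add: PiE_iff)
    with True show ?thesis unfolding swap_tensor_def mats_def by (auto intro!: eq_matI)
  next
    case False
    then show ?thesis using PiE_arb[OF f, of l] by (simp add: swap_tensor_def)
  qed
qed

text \<open>After interchanging the two sums, the bilinear expression for the swapped tensor is the
  original one with \<open>c\<close> and \<open>x\<close> in exchanged roles, and the defining
  condition treats these two vectors alike.\<close>

lemma swap_tensor_in_tensors:
  assumes f: "f \<in> tensors K a m k"
  shows "swap_tensor a m k f \<in> tensors K k m a"
proof -
  have fm: "f l $$ (i, j) \<in> carrier K" if "l < k" "i < a" "j < m" for l i j
    using f that unfolding tensors_def by (simp add: PiE_iff mats_def)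
  have "swap_tensor a m k f \<in> {..<a} \<rightarrow>\<^sub>E mats K k m"
    unfolding swap_tensor_def restrict_PiE_iff using fm by (simp add: mat_in_mats_iff)
  moreover have "\<exists>j<m. (\<Oplus>l\<in>{..<k}. x l \<otimes> (\<Oplus>i\<in>{..<a}. c i \<otimes> swap_tensor a m k f i $$ (l, j))) \<noteq> \<zero>"
    if c: "c \<in> coords K a" and x: "x \<in> coords K k" and nz: "\<exists>i<a. c i \<noteq> \<zero>" "\<exists>l<k. x l \<noteq> \<zero>" for c x
  proof -
    obtain j where j: "j < m" "(\<Oplus>i\<in>{..<a}. c i \<otimes> (\<Oplus>l\<in>{..<k}. x l \<otimes> f l $$ (i, j))) \<noteq> \<zero>"
      using f c x nz unfolding tensors_def by blast
    have c': "c i \<in> carrier K" if "i < a" for i using c that by (simp add: PiE_iff)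
    have x': "x l \<in> carrier K" if "l < k" for l using x that by (simp add: PiE_iff)
    have "(\<Oplus>l\<in>{..<k}. x l \<otimes> (\<Oplus>i\<in>{..<a}. c i \<otimes> swap_tensor a m k f i $$ (l, j)))
        = (\<Oplus>l\<in>{..<k}. \<Oplus>i\<in>{..<a}. c i \<otimes> (x l \<otimes> f l $$ (i, j)))"
    proof (rule finsum_cong'[OF refl])
      fix l assume l: "l \<in> {..<k}"
      have "(\<Oplus>i\<in>{..<a}. c i \<otimes> swap_tensor a m k f i $$ (l, j)) = (\<Oplus>i\<in>{..<a}. c i \<otimes> f l $$ (i, j))"
        using l j c' fm by (intro finsum_cong') (auto simp: swap_tensor_def)
      also have "x l \<otimes> \<dots> = (\<Oplus>i\<in>{..<a}. x l \<otimes> (c i \<otimes> f l $$ (i, j)))"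
        using l j c' x' fm by (intro finsum_rdistr) auto
      also have "\<dots> = (\<Oplus>i\<in>{..<a}. c i \<otimes> (x l \<otimes> f l $$ (i, j)))"
        using l j c' x' fm by (intro finsum_cong') (auto simp: m_lcomm)
      finally show "x l \<otimes> (\<Oplus>i\<in>{..<a}. c i \<otimes> swap_tensor a m k f i $$ (l, j))
          = (\<Oplus>i\<in>{..<a}. c i \<otimes> (x l \<otimes> f l $$ (i, j)))" .
    qed (use c' x' fm j in \<open>auto intro!: finsum_closed\<close>)
    also have "\<dots> = (\<Oplus>i\<in>{..<a}. \<Oplus>l\<in>{..<k}. c i \<otimes> (x l \<otimes> f l $$ (i, j)))"
      using c' x' fm j by (intro finsum_finsum_swap) auto
    also have "\<dots> = (\<Oplus>i\<in>{..<a}. c i \<otimes> (\<Oplus>l\<in>{..<k}. x l \<otimes> f l $$ (i, j)))"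
    proof (rule finsum_cong'[OF refl])
      fix i assume "i \<in> {..<a}"
      then show "(\<Oplus>l\<in>{..<k}. c i \<otimes> (x l \<otimes> f l $$ (i, j))) = c i \<otimes> (\<Oplus>l\<in>{..<k}. x l \<otimes> f l $$ (i, j))"
        using c' x' fm j by (intro finsum_rdistr[symmetric]) auto
    qed (use c' x' fm j in \<open>auto intro!: finsum_closed\<close>)
    finally show ?thesis using j by auto
  qed
  ultimately show ?thesis unfolding tensors_def by blast
qed

lemma card_tensors_swap: "card (tensors K a m k) = card (tensors K k m a)"
proof -
  have "bij_betw (swap_tensor a m k) (tensors K a m k) (tensors K k m a)"
  proof (rule bij_betw_byWitness[where f' = "swap_tensor k m a"])
    show "\<forall>f\<in>tensors K a m k. swap_tensor k m a (swap_tensor a m k f) = f"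
      "\<forall>f\<in>tensors K k m a. swap_tensor a m k (swap_tensor k m a f) = f"
      unfolding tensors_def using swap_tensor_swap_tensor by blast+
  qed (use swap_tensor_in_tensors in blast)+
  then show ?thesis by (rule bij_betw_same_card)
qed

end

section \<open>The general linear group\<close>

lemma mat_monoid_simps [simp]:
  "carrier (mat_monoid K a) = mats K a a"
  "mult (mat_monoid K a) A B
     = mat a a (\<lambda>(i, j). \<Oplus>\<^bsub>K\<^esub>k\<in>{..<a}. A $$ (i, k) \<otimes>\<^bsub>K\<^esub> B $$ (k, j))"
  "one (mat_monoid K a) = mat a a (\<lambda>(i, j). if i = j then \<one>\<^bsub>K\<^esub> else \<zero>\<^bsub>K\<^esub>)"
  unfolding mat_monoid_def by auto

context finite_field
begin

lemma finsum_delta: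
  fixes a :: nat
  assumes "i < a" "\<And>k. k < a \<Longrightarrow> x k \<in> carrier K"
  shows "(\<Oplus>k\<in>{..<a}. x k \<otimes> (if k = i then \<one> else \<zero>)) = x i"
    and "(\<Oplus>k\<in>{..<a}. (if i = k then \<one> else \<zero>) \<otimes> x k) = x i"
proof -
  have "(\<Oplus>k\<in>{..<a}. if i = k then x k else \<zero>) = x i"
    using assms by (intro add.finprod_singleton) auto
  moreover have "(\<Oplus>k\<in>{..<a}. x k \<otimes> (if k = i then \<one> else \<zero>)) = (\<Oplus>k\<in>{..<a}. if i = k then x k else \<zero>)"
    "(\<Oplus>k\<in>{..<a}. (if i = k then \<one> else \<zero>) \<otimes> x k) = (\<Oplus>k\<in>{..<a}. if i = k then x k else \<zero>)"
    using assms by (intro finsum_cong'; auto)+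
  ultimately show "(\<Oplus>k\<in>{..<a}. x k \<otimes> (if k = i then \<one> else \<zero>)) = x i"
    "(\<Oplus>k\<in>{..<a}. (if i = k then \<one> else \<zero>) \<otimes> x k) = x i" by simp_all
qed

lemma monoid_mat_monoid: "monoid (mat_monoid K a)"
proof (rule monoidI)
  fix A B assume "A \<in> carrier (mat_monoid K a)" "B \<in> carrier (mat_monoid K a)"
  then show "A \<otimes>\<^bsub>mat_monoid K a\<^esub> B \<in> carrier (mat_monoid K a)"
    by (auto simp: mat_in_mats_iff mats_def intro!: finsum_closed)
next
  fix A B C
  assume ABC: "A \<in> carrier (mat_monoid K a)" "B \<in> carrier (mat_monoid K a)" "C \<in> carrier (mat_monoid K a)"
  have A: "A $$ (i, j) \<in> carrier K" and B: "B $$ (i, j) \<in> carrier K" and C: "C $$ (i, j) \<in> carrier K"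
    if "i < a" "j < a" for i j using that ABC by (auto simp: mats_def)
  have "(\<Oplus>l\<in>{..<a}. (\<Oplus>k\<in>{..<a}. A $$ (i, k) \<otimes> B $$ (k, l)) \<otimes> C $$ (l, j))
      = (\<Oplus>k\<in>{..<a}. A $$ (i, k) \<otimes> (\<Oplus>l\<in>{..<a}. B $$ (k, l) \<otimes> C $$ (l, j)))"
    if ij: "i < a" "j < a" for i j
  proof -
    have "(\<Oplus>l\<in>{..<a}. (\<Oplus>k\<in>{..<a}. A $$ (i, k) \<otimes> B $$ (k, l)) \<otimes> C $$ (l, j))
        = (\<Oplus>l\<in>{..<a}. \<Oplus>k\<in>{..<a}. A $$ (i, k) \<otimes> (B $$ (k, l) \<otimes> C $$ (l, j)))"
    proof (rule finsum_cong'[OF refl])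
      fix l assume l: "l \<in> {..<a}"
      have "(\<Oplus>k\<in>{..<a}. A $$ (i, k) \<otimes> B $$ (k, l)) \<otimes> C $$ (l, j)
          = (\<Oplus>k\<in>{..<a}. A $$ (i, k) \<otimes> B $$ (k, l) \<otimes> C $$ (l, j))"
        using l ij A B C by (intro finsum_ldistr) auto
      also have "\<dots> = (\<Oplus>k\<in>{..<a}. A $$ (i, k) \<otimes> (B $$ (k, l) \<otimes> C $$ (l, j)))"
        using l ij A B C by (intro finsum_cong') (auto simp: m_assoc)
      finally show "(\<Oplus>k\<in>{..<a}. A $$ (i, k) \<otimes> B $$ (k, l)) \<otimes> C $$ (l, j)
          = (\<Oplus>k\<in>{..<a}. A $$ (i, k) \<otimes> (B $$ (k, l) \<otimes> C $$ (l, j)))" .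
    qed (use ij A B C in \<open>auto intro!: finsum_closed\<close>)
    also have "\<dots> = (\<Oplus>k\<in>{..<a}. \<Oplus>l\<in>{..<a}. A $$ (i, k) \<otimes> (B $$ (k, l) \<otimes> C $$ (l, j)))"
      using ij A B C by (intro finsum_finsum_swap) auto
    also have "\<dots> = (\<Oplus>k\<in>{..<a}. A $$ (i, k) \<otimes> (\<Oplus>l\<in>{..<a}. B $$ (k, l) \<otimes> C $$ (l, j)))"
    proof (rule finsum_cong'[OF refl])
      fix k assume "k \<in> {..<a}"
      then show "(\<Oplus>l\<in>{..<a}. A $$ (i, k) \<otimes> (B $$ (k, l) \<otimes> C $$ (l, j)))
          = A $$ (i, k) \<otimes> (\<Oplus>l\<in>{..<a}. B $$ (k, l) \<otimes> C $$ (l, j))"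
        using ij A B C by (intro finsum_rdistr[symmetric]) auto
    qed (use ij A B C in \<open>auto intro!: finsum_closed\<close>)
    finally show ?thesis .
  qed
  moreover have "(\<Oplus>l\<in>{..<a}. mat a a F $$ (i, l) \<otimes> C $$ (l, j)) = (\<Oplus>l\<in>{..<a}. F (i, l) \<otimes> C $$ (l, j))"
    "(\<Oplus>l\<in>{..<a}. A $$ (i, l) \<otimes> mat a a F $$ (l, j)) = (\<Oplus>l\<in>{..<a}. A $$ (i, l) \<otimes> F (l, j))"
    if "i < a" "j < a" "\<And>i j. i < a \<Longrightarrow> j < a \<Longrightarrow> F (i, j) \<in> carrier K" for i j F
    using that A C by (intro finsum_cong'; auto)+
  ultimately show "A \<otimes>\<^bsub>mat_monoid K a\<^esub> B \<otimes>\<^bsub>mat_monoid K a\<^esub> C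
      = A \<otimes>\<^bsub>mat_monoid K a\<^esub> (B \<otimes>\<^bsub>mat_monoid K a\<^esub> C)"
    using A B C by (intro eq_matI) (simp_all add: finsum_closed)
next
  fix A assume A: "A \<in> carrier (mat_monoid K a)"
  have "(\<Oplus>k\<in>{..<a}. \<one>\<^bsub>mat_monoid K a\<^esub> $$ (i, k) \<otimes> A $$ (k, j)) = A $$ (i, j)"
    "(\<Oplus>k\<in>{..<a}. A $$ (i, k) \<otimes> \<one>\<^bsub>mat_monoid K a\<^esub> $$ (k, j)) = A $$ (i, j)"
    if "i < a" "j < a" for i j
  proof -
    have "(\<Oplus>k\<in>{..<a}. \<one>\<^bsub>mat_monoid K a\<^esub> $$ (i, k) \<otimes> A $$ (k, j))
        = (\<Oplus>k\<in>{..<a}. (if i = k then \<one> else \<zero>) \<otimes> A $$ (k, j))"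
      using that A by (intro finsum_cong') (auto simp: mats_def)
    then show "(\<Oplus>k\<in>{..<a}. \<one>\<^bsub>mat_monoid K a\<^esub> $$ (i, k) \<otimes> A $$ (k, j)) = A $$ (i, j)"
      using finsum_delta(2)[of i a "\<lambda>k. A $$ (k, j)"] that A by (simp add: mats_def)
    have "(\<Oplus>k\<in>{..<a}. A $$ (i, k) \<otimes> \<one>\<^bsub>mat_monoid K a\<^esub> $$ (k, j))
        = (\<Oplus>k\<in>{..<a}. A $$ (i, k) \<otimes> (if k = j then \<one> else \<zero>))"
      using that A by (intro finsum_cong') (auto simp: mats_def)
    then show "(\<Oplus>k\<in>{..<a}. A $$ (i, k) \<otimes> \<one>\<^bsub>mat_monoid K a\<^esub> $$ (k, j)) = A $$ (i, j)"
      using finsum_delta(1)[of j a "\<lambda>k. A $$ (i, k)"] that A by (simp add: mats_def)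
  qed
  then show "\<one>\<^bsub>mat_monoid K a\<^esub> \<otimes>\<^bsub>mat_monoid K a\<^esub> A = A"
    "A \<otimes>\<^bsub>mat_monoid K a\<^esub> \<one>\<^bsub>mat_monoid K a\<^esub> = A"
    using A by (auto intro!: eq_matI simp del: mat_monoid_simps(3) simp: mats_def)
qed (simp add: mat_in_mats_iff)

text \<open>Each column of a product \<open>A B\<close> is the combination of the columns of
  \<open>A\<close> with coefficients from the same column of \<open>B\<close>. A left inverse
  therefore excludes relations among the columns; conversely, independent columns span the space,
  which yields a right inverse, and injectivity of the combination map makes it two-sided.\<close>

lemma Units_mat_monoid_iff:
  assumes A: "A \<in> mats K a a"
  shows "A \<in> Units (mat_monoid K a) \<longleftrightarrow> (\<lambda>j\<in>{..<a}. col A j) \<in> frames K (vec_module K a) a"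
proof -
  let ?M = "mat_monoid K a" and ?V = "vec_module K a" and ?f = "\<lambda>j\<in>{..<a}. col A j"
  interpret M: monoid ?M by (rule monoid_mat_monoid)
  interpret V: finite_vectorspace K ?V by (rule finite_vectorspace_vec)
  have dims: "dim_row A = a" "dim_col A = a" using A by (auto simp: mats_def)
  have A': "A $$ (i, j) \<in> carrier K" if "i < a" "j < a" for i j using A that by (auto simp: mats_def)
  have f: "?f \<in> {..<a} \<rightarrow>\<^sub>E carrier ?V"
    unfolding restrict_PiE_iff using A dims by (simp add: mats_def)
  then have f': "?f \<in> {..<a} \<rightarrow> carrier ?V" by (simp add: PiE_iff)
  have comb: "lcomb ?V c ?f a $ i = (\<Oplus>l\<in>{..<a}. A $$ (i, l) \<otimes> c l)"
    if c: "c \<in> {..<a} \<rightarrow> carrier K" and i: "i < a" for c i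
  proof -
    have "lcomb ?V c ?f a $ i = (\<Oplus>l\<in>{..<a}. c l \<otimes> ?f l $ i)" by (rule lcomb_vec_index[OF c f' i])
    also have "\<dots> = (\<Oplus>l\<in>{..<a}. A $$ (i, l) \<otimes> c l)"
      using c i A' dims by (intro finsum_cong') (auto simp: m_comm Pi_iff)
    finally show ?thesis .
  qed
  have comb_mult: "(A \<otimes>\<^bsub>?M\<^esub> B) $$ (i, j) = lcomb ?V (\<lambda>l. B $$ (l, j)) ?f a $ i"
    if "B \<in> mats K a a" "i < a" "j < a" for B i j
    using that by (subst comb) (auto simp: mats_def)
  have combV: "lcomb ?V c ?f a \<in> carrier_vec a" if "c \<in> {..<a} \<rightarrow> carrier K" for c
    using V.lcomb_closed[OF that f'] by simp
  show ?thesis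
  proof
    assume "A \<in> Units ?M"
    then obtain B where B: "B \<in> mats K a a" "B \<otimes>\<^bsub>?M\<^esub> A = \<one>\<^bsub>?M\<^esub>" unfolding Units_def by auto
    have "c i = \<zero>" if c: "c \<in> coords K a" and z: "lcomb ?V c ?f a = \<zero>\<^bsub>?V\<^esub>" and i: "i < a" for c i
    proof -
      \<comment> \<open>All columns of \<open>C\<close> equal the relation \<open>c\<close>, so that
        \<open>A C = 0\<close>; multiplying by the left inverse gives \<open>C = 0\<close>.\<close>
      define C where "C = mat a a (\<lambda>(l, j). c l)"
      have C: "C \<in> mats K a a" unfolding C_def mat_in_mats_iff using c by (simp add: PiE_iff)
      have "(A \<otimes>\<^bsub>?M\<^esub> C) $$ (l, j) = \<zero>" if "l < a" "j < a" for l j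
      proof -
        have "(A \<otimes>\<^bsub>?M\<^esub> C) $$ (l, j) = lcomb ?V c ?f a $ l"
          unfolding comb_mult[OF C that] using that
          by (intro arg_cong[where f = "\<lambda>v. v $ l"] lcomb_cong) (auto simp: C_def)
        then show ?thesis using z that by simp
      qed
      then have "(B \<otimes>\<^bsub>?M\<^esub> (A \<otimes>\<^bsub>?M\<^esub> C)) $$ (i, i) = \<zero>"
        using i B(1) by (simp del: mat_monoid_simps(2) add: mat_monoid_simps(2)[of K a B])
          (intro finsum_all0, auto simp: mats_def simp del: mat_monoid_simps)
      moreover have "B \<otimes>\<^bsub>?M\<^esub> (A \<otimes>\<^bsub>?M\<^esub> C) = C"
        using M.m_assoc[of B A C] M.l_one[of C] A B C by (simp del: mat_monoid_simps add: mat_monoid_simps(1))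
      ultimately have "C $$ (i, i) = \<zero>" by metis
      then show ?thesis using i by (simp add: C_def)
    qed
    then show "?f \<in> frames K ?V a" unfolding frames_def mem_Collect_eq using f by blast
  next
    assume fr: "?f \<in> frames K ?V a"
    have span: "lspan K ?V a ?f = carrier ?V"
      by (rule V.lspan_frame_eq[OF fr card_vec_module])
    have "\<exists>c\<in>coords K a. lcomb ?V c ?f a = vec a (\<lambda>i. if i = j then \<one> else \<zero>)" for j
    proof -
      have "vec a (\<lambda>i. if i = j then \<one> else \<zero>) \<in> lspan K ?V a ?f" unfolding span by simp
      then show ?thesis unfolding lspan_def by auto
    qed
    then obtain c where c: "\<And>j. c j \<in> coords K a"
      "\<And>j. lcomb ?V (c j) ?f a = vec a (\<lambda>i. if i = j then \<one> else \<zero>)" by metis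
    define B where "B = mat a a (\<lambda>(l, j). c j l)"
    have B: "B \<in> mats K a a" unfolding B_def mat_in_mats_iff using c(1) by (simp add: PiE_iff)
    have AB: "A \<otimes>\<^bsub>?M\<^esub> B = \<one>\<^bsub>?M\<^esub>"
    proof (rule mats_eqI)
      show "A \<otimes>\<^bsub>?M\<^esub> B \<in> mats K a a" "\<one>\<^bsub>?M\<^esub> \<in> mats K a a"
        using M.m_closed[of A B] M.one_closed A B by simp_all
      fix i j assume ij: "i < a" "j < a"
      have "lcomb ?V (\<lambda>l. B $$ (l, j)) ?f a = lcomb ?V (c j) ?f a"
        using ij by (intro lcomb_cong) (auto simp: B_def)
      then show "(A \<otimes>\<^bsub>?M\<^esub> B) $$ (i, j) = \<one>\<^bsub>?M\<^esub> $$ (i, j)"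
        unfolding comb_mult[OF B ij] using c(2)[of j] ij by simp
    qed
    have inj: "P = Q" if P: "P \<in> mats K a a" and Q: "Q \<in> mats K a a"
      and eq: "A \<otimes>\<^bsub>?M\<^esub> P = A \<otimes>\<^bsub>?M\<^esub> Q" for P Q
    proof (rule mats_eqI[OF P Q])
      fix i j assume ij: "i < a" "j < a"
      let ?p = "\<lambda>l. P $$ (l, j)" and ?q = "\<lambda>l. Q $$ (l, j)"
      have pq: "?p \<in> {..<a} \<rightarrow> carrier K" "?q \<in> {..<a} \<rightarrow> carrier K"
        using P Q ij by (auto simp: mats_def)
      have "lcomb ?V ?p ?f a = lcomb ?V ?q ?f a"
      proof (rule eq_vecI)
        fix l assume "l < dim_vec (lcomb ?V ?q ?f a)"
        then have l: "l < a" using combV[OF pq(2)] by simp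
        show "lcomb ?V ?p ?f a $ l = lcomb ?V ?q ?f a $ l"
          using comb_mult[OF P l ij(2)] comb_mult[OF Q l ij(2)] eq by metis
      qed (use combV[OF pq(1)] combV[OF pq(2)] in simp)
      then have "lcomb ?V (restrict ?p {..<a}) ?f a = lcomb ?V (restrict ?q {..<a}) ?f a"
        by (metis lcomb_restrict(1))
      moreover have "restrict ?p {..<a} \<in> coords K a" "restrict ?q {..<a} \<in> coords K a"
        unfolding restrict_PiE_iff using pq by auto
      ultimately have "restrict ?p {..<a} = restrict ?q {..<a}"
        using V.frames_inj_on[OF fr] by (metis (no_types, lifting) inj_onD)
      then show "P $$ (i, j) = Q $$ (i, j)" using ij by (metis lessThan_iff restrict_apply')
    qed
    \<comment> \<open>From \<open>A B = 1\<close> follows \<open>A (B A) = A\<close>, and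
      \<open>inj\<close> allows cancelling \<open>A\<close> on the left.\<close>
    have "A \<otimes>\<^bsub>?M\<^esub> (B \<otimes>\<^bsub>?M\<^esub> A) = A \<otimes>\<^bsub>?M\<^esub> \<one>\<^bsub>?M\<^esub>"
      using M.m_assoc[of A B A, symmetric] M.l_one[of A] M.r_one[of A] A B AB
      by (simp del: mat_monoid_simps add: mat_monoid_simps(1))
    from inj[OF _ _ this] have "B \<otimes>\<^bsub>?M\<^esub> A = \<one>\<^bsub>?M\<^esub>"
      using M.m_closed[of B A] M.one_closed A B
      by (simp del: mat_monoid_simps add: mat_monoid_simps(1))
    then show "A \<in> Units ?M" unfolding Units_def using A B AB by auto
  qed
qed

lemma card_Units_mat_monoid:
  "card (Units (mat_monoid K a)) = (\<Prod>j<a. card (carrier K) ^ a - card (carrier K) ^ j)"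
proof -
  interpret V: finite_vectorspace K "vec_module K a" by (rule finite_vectorspace_vec)
  let ?g = "\<lambda>f. mat a a (\<lambda>(i, j). f j $ i)"
  have U: "A \<in> mats K a a" if "A \<in> Units (mat_monoid K a)" for A
    using that unfolding Units_def by auto
  have col_g: "(\<lambda>j\<in>{..<a}. col (?g f) j) = f" if f: "f \<in> frames K (vec_module K a) a" for f
  proof
    fix j
    have f': "f \<in> {..<a} \<rightarrow>\<^sub>E carrier (vec_module K a)" using f unfolding frames_def by blast
    show "(\<lambda>j\<in>{..<a}. col (?g f) j) j = f j"
    proof (cases "j < a")
      case True
      then have "f j \<in> carrier_vec a" using f' by (simp add: PiE_iff)
      then show ?thesis using True by (auto intro!: eq_vecI)
    next
      case False
      then show ?thesis using PiE_arb[OF f', of j] by simp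
    qed
  qed
  have "bij_betw (\<lambda>A. \<lambda>j\<in>{..<a}. col A j) (Units (mat_monoid K a)) (frames K (vec_module K a) a)"
  proof (rule bij_betw_byWitness[where f' = ?g])
    show "\<forall>A\<in>Units (mat_monoid K a). ?g (\<lambda>j\<in>{..<a}. col A j) = A"
    proof
      fix A assume "A \<in> Units (mat_monoid K a)"
      then have "A \<in> carrier_mat a a" using U by (auto simp: mats_def)
      then show "?g (\<lambda>j\<in>{..<a}. col A j) = A" by (intro eq_matI) auto
    qed
    show "\<forall>f\<in>frames K (vec_module K a) a. (\<lambda>j\<in>{..<a}. col (?g f) j) = f"
      using col_g by blast
    show "(\<lambda>A. \<lambda>j\<in>{..<a}. col A j) ` Units (mat_monoid K a) \<subseteq> frames K (vec_module K a) a"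
      using Units_mat_monoid_iff U by blast
    show "?g ` frames K (vec_module K a) a \<subseteq> Units (mat_monoid K a)"
    proof
      fix A assume "A \<in> ?g ` frames K (vec_module K a) a"
      then obtain f where f: "f \<in> frames K (vec_module K a) a" and A: "A = ?g f" by blast
      have "?g f \<in> mats K a a"
        using f unfolding mat_in_mats_iff frames_def by (simp add: PiE_iff)
      then show "A \<in> Units (mat_monoid K a)"
        unfolding A by (subst Units_mat_monoid_iff) (use col_g[OF f] f in auto)
    qed
  qed
  then have "card (Units (mat_monoid K a)) = card (frames K (vec_module K a) a)"
    by (rule bij_betw_same_card)
  then show ?thesis by (simp add: V.card_frames[OF V.finite_vectors] card_vec_module del: vec_module_simps)
qed

end

section \<open>Nonsingular tensors from extension fields\<close>

lemma (in module) lcomb_extend_by_zero: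
  assumes "r \<le> n" "e \<in> {..<n} \<rightarrow> carrier M" "c \<in> {..<r} \<rightarrow> carrier R"
    "\<And>i. r \<le> i \<Longrightarrow> i < n \<Longrightarrow> c i = \<zero>"
  shows "lcomb M c e n = lcomb M c e r"
  using assms
proof (induction n rule: dec_induct)
  case (step n)
  have "lcomb M c e r \<in> carrier M" using step by (intro lcomb_closed) (auto simp: Pi_iff)
  moreover have "e n \<in> carrier M" using step by (auto simp: Pi_iff)
  moreover have "lcomb M c e n = lcomb M c e r" using step by (auto simp: Pi_iff)
  ultimately show ?case using step by simp
qed simp

context finite_field
begin

text \<open>The structure constants of the multiplication of an extension field of degree \<open>n\<close>, restricted to
  the first \<open>r\<close> basis vectors in one argument, are nondegenerate because a field has no zero divisors.\<close>

lemma tensors_nonempty: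
  assumes L: "field L" "finite (carrier L)" "card (carrier L) = card (carrier K) ^ n"
    and h: "h \<in> ring_hom K L" and r: "r \<le> n"
  shows "tensors K n n r \<noteq> {}"
proof -
  interpret L: field L by (rule L(1))
  interpret h: ring_hom_ring K L h using h ring_axioms L.ring_axioms by (intro ring_hom_ringI2)
  define V where "V = \<lparr>carrier = carrier L, mult = mult L, one = one L, zero = zero L, add = add L,
      smult = (\<lambda>c v. h c \<otimes>\<^bsub>L\<^esub> v)\<rparr>"
  have V [simp]: "carrier V = carrier L" "zero V = zero L" "add V = add L"
    "smult V c v = h c \<otimes>\<^bsub>L\<^esub> v" for c v
    unfolding V_def by simp_all
  have "module K V"
  proof (rule module_criteria)
    show "\<forall>v\<in>carrier V. \<exists>w\<in>carrier V. v \<oplus>\<^bsub>V\<^esub> w = \<zero>\<^bsub>V\<^esub>"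
      using L.r_neg by fastforce
  qed (auto intro: is_cring simp: L.a_ac L.m_assoc L.l_distr L.r_distr)
  then interpret V: finite_vectorspace K V
    using field_axioms finite_carrier L(2)
    by (auto simp: finite_vectorspace_def finite_vectorspace_axioms_def vectorspace_def)
  have cardV: "card (carrier V) = card (carrier K) ^ n" using L(3) by simp
  obtain e where e: "e \<in> frames K V n" using V.frame_exists[OF cardV] by blast
  have span: "lspan K V n e = carrier L" using V.lspan_frame_eq[OF e cardV] by simp
  have e': "e \<in> {..<n} \<rightarrow> carrier V" using e unfolding frames_def by (simp add: PiE_iff)
  have eL: "e i \<in> carrier L" if "i < n" for i using e' that by auto
  \<comment> \<open>The range conditions sit inside the existential, with the zero vector as default
    outside the range, so that the choice of structure constants \<open>T\<close> lies in
    \<open>coords K n\<close> for all indices.\<close>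
  have "\<exists>t\<in>coords K n. i < n \<longrightarrow> l < n \<longrightarrow> lcomb V t e n = e i \<otimes>\<^bsub>L\<^esub> e l" for i l
  proof (cases "i < n \<and> l < n")
    case True
    then have "e i \<otimes>\<^bsub>L\<^esub> e l \<in> lspan K V n e" unfolding span using eL by simp
    then show ?thesis unfolding lspan_def by auto
  next
    case False
    have "(\<lambda>i\<in>{..<n}. \<zero>) \<in> coords K n" by simp
    then show ?thesis using False by blast
  qed
  then obtain T where T: "\<And>i l. T i l \<in> coords K n"
    "\<And>i l. i < n \<Longrightarrow> l < n \<Longrightarrow> lcomb V (T i l) e n = e i \<otimes>\<^bsub>L\<^esub> e l" by metis
  have TK: "T i l j \<in> carrier K" if "j < n" for i l j using T(1)[of i l] that by (simp add: PiE_iff)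
  define f where "f = (\<lambda>i\<in>{..<r}. mat n n (\<lambda>(l, j). T i l j))"
  have f: "f \<in> {..<r} \<rightarrow>\<^sub>E mats K n n"
    unfolding f_def restrict_PiE_iff mat_in_mats_iff using TK by simp
  have lcomb_mult: "lcomb V c (\<lambda>i. u \<otimes>\<^bsub>L\<^esub> g i) k = u \<otimes>\<^bsub>L\<^esub> lcomb V c g k"
    if "c \<in> {..<k} \<rightarrow> carrier K" "g \<in> {..<k} \<rightarrow> carrier L" "u \<in> carrier L" for c g u k
    using that
  proof (induction k)
    case (Suc k)
    have "lcomb V c g k \<in> carrier L" using V.lcomb_closed[of c k g] Suc.prems by (simp add: Pi_iff)
    then show ?case using Suc by (auto simp: Pi_iff L.r_distr L.m_lcomm)
  qed simp
  have "\<exists>j<n. (\<Oplus>l\<in>{..<n}. x l \<otimes> (\<Oplus>i\<in>{..<r}. c i \<otimes> f i $$ (l, j))) \<noteq> \<zero>"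
    if c: "c \<in> coords K r" and x: "x \<in> coords K n" and nz: "\<exists>i<r. c i \<noteq> \<zero>" "\<exists>l<n. x l \<noteq> \<zero>" for c x
  proof (rule ccontr)
    assume "\<not> ?thesis"
    then have z: "(\<Oplus>l\<in>{..<n}. x l \<otimes> (\<Oplus>i\<in>{..<r}. c i \<otimes> f i $$ (l, j))) = \<zero>" if "j < n" for j
      using that by blast
    have c': "c \<in> {..<r} \<rightarrow> carrier K" and x': "x \<in> {..<n} \<rightarrow> carrier K"
      using c x by (simp_all add: PiE_iff)
    define s where "s l j = (\<Oplus>i\<in>{..<r}. c i \<otimes> T i l j)" for l j
    have sK: "s l \<in> {..<n} \<rightarrow> carrier K" for l
      unfolding s_def using c' TK by (auto simp: Pi_iff intro!: finsum_closed)
    have s: "(\<Oplus>i\<in>{..<r}. c i \<otimes> f i $$ (l, j)) = s l j" if "l < n" "j < n" for l j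
      unfolding s_def using that c' TK by (intro finsum_cong') (auto simp: f_def Pi_iff)
    have "(\<Oplus>l\<in>{..<n}. x l \<otimes> s l j) = \<zero>" if "j < n" for j
    proof -
      have "(\<Oplus>l\<in>{..<n}. x l \<otimes> s l j) = (\<Oplus>l\<in>{..<n}. x l \<otimes> (\<Oplus>i\<in>{..<r}. c i \<otimes> f i $$ (l, j)))"
        using that x' s sK by (intro finsum_cong') (auto simp: Pi_iff)
      then show ?thesis using z[OF that] by simp
    qed
    \<comment> \<open>The vanishing sums are the coordinates, in the basis \<open>e\<close>, of the
      product of the field elements with coordinates \<open>c\<close> and \<open>x\<close>. Hence
      this product is zero although both factors will turn out to be nonzero.\<close>
    then have "\<zero>\<^bsub>L\<^esub> = lcomb V (\<lambda>j. \<Oplus>l\<in>{..<n}. x l \<otimes> s l j) e n"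
      using V.lcomb_zero[OF e', of "\<lambda>j. \<Oplus>l\<in>{..<n}. x l \<otimes> s l j"] by simp
    also have "\<dots> = lcomb V x (\<lambda>l. lcomb V (s l) e n) n"
      by (rule V.lcomb_finsum[OF x' sK e'])
    also have "\<dots> = lcomb V x (\<lambda>l. lcomb V c e r \<otimes>\<^bsub>L\<^esub> e l) n"
    proof (rule lcomb_cong[OF refl])
      fix l assume l: "l < n"
      have "lcomb V (s l) e n = lcomb V c (\<lambda>i. lcomb V (T i l) e n) r"
        unfolding s_def using TK by (intro V.lcomb_finsum[OF c' _ e']) auto
      also have "\<dots> = lcomb V c (\<lambda>i. e l \<otimes>\<^bsub>L\<^esub> e i) r"
        using T(2) l r eL by (intro lcomb_cong) (auto simp: L.m_comm)
      also have "\<dots> = e l \<otimes>\<^bsub>L\<^esub> lcomb V c e r"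
        using l r eL by (intro lcomb_mult[OF c']) auto
      finally show "lcomb V (s l) e n = lcomb V c e r \<otimes>\<^bsub>L\<^esub> e l"
        using l eL V.lcomb_closed[OF c', of e] r by (auto simp: Pi_iff L.m_comm)
    qed
    also have "\<dots> = lcomb V c e r \<otimes>\<^bsub>L\<^esub> lcomb V x e n"
      using V.lcomb_closed[OF c', of e] eL r by (intro lcomb_mult[OF x']) (auto simp: Pi_iff)
    finally have prod: "lcomb V c e r \<otimes>\<^bsub>L\<^esub> lcomb V x e n = \<zero>\<^bsub>L\<^esub>" by simp
    have ne_x: "lcomb V x e n \<noteq> \<zero>\<^bsub>L\<^esub>"
      using framesD[OF e x] nz(2) by auto
    \<comment> \<open>Padding \<open>c\<close> with zeros turns a combination of the first
      \<open>r\<close> basis vectors into one of the whole basis, to which independence of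
      \<open>e\<close> applies.\<close>
    let ?c = "\<lambda>i\<in>{..<n}. if i < r then c i else \<zero>"
    have cc: "?c \<in> coords K n" unfolding restrict_PiE_iff using c' by auto
    have "lcomb V ?c e n = lcomb V ?c e r"
      using r c' by (intro V.lcomb_extend_by_zero[OF r e']) auto
    also have "\<dots> = lcomb V c e r" using r by (intro lcomb_cong) auto
    finally have eq: "lcomb V ?c e n = lcomb V c e r" .
    obtain i where i: "i < r" "c i \<noteq> \<zero>" using nz(1) by blast
    have "lcomb V c e r \<noteq> \<zero>\<^bsub>L\<^esub>"
      using framesD[OF e cc, of i] eq i r by auto
    then show False
      using prod ne_x L.integral_iff V.lcomb_closed[OF c', of e] V.lcomb_closed[OF x' e'] eL r
      by (auto simp: Pi_iff)
  qed
  then have "f \<in> tensors K n n r" unfolding tensors_def mem_Collect_eq using f by blast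
  then show ?thesis by blast
qed

end

section \<open>Densities\<close>

text \<open>Both sides of the equation count nonsingular tensors, which \<open>swap_tensor\<close>
  matches bijectively. Positivity comes from the tensor given by an extension field of degree
  \<open>n\<close>.\<close>

lemma card_rank_codes_swap:
  assumes q: "primepow q" and r: "1 \<le> r" "r \<le> n"
  shows "card (rank_codes (GF q) r n n r) * (\<Prod>j<n. q ^ n - q ^ j)
           = card (rank_codes (GF q) n n r n) * (\<Prod>j<r. q ^ r - q ^ j)"
    and "0 < card (rank_codes (GF q) n n r n)"
proof -
  interpret finite_field "GF q"
    using GF[OF q] by (simp add: finite_field_def finite_field_axioms_def)
  have card: "card (carrier (GF q)) = q" by (rule GF(3)[OF q])
  have t: "card (tensors (GF q) n n r) = card (rank_codes (GF q) n n r n) * (\<Prod>j<r. q ^ r - q ^ j)"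
    using card_tensors[of n n r] r unfolding card by simp
  show "card (rank_codes (GF q) r n n r) * (\<Prod>j<n. q ^ n - q ^ j)
           = card (rank_codes (GF q) n n r n) * (\<Prod>j<r. q ^ r - q ^ j)"
    using card_tensors[of r n n] card_tensors_swap[of r n n] r t unfolding card by simp
  obtain p e where p: "Factorial_Ring.prime p" "q = p ^ e" using q by (auto simp: primepow_def)
  obtain L :: "((nat list \<times> nat) multiset \<Rightarrow> nat) ring" and h
    where L: "field L" "finite (carrier L)" "card (carrier L) = card (carrier (GF q)) ^ n"
      "h \<in> ring_hom (GF q) L"
    using finite_extension_exists[OF finite_carrier _ p(1), of e n] p(2) card r by auto
  have "tensors (GF q) n n r \<noteq> {}" by (rule tensors_nonempty[OF L r(2)])
  moreover have "finite (tensors (GF q) n n r)"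
    by (rule finite_subset[of _ "{..<r} \<rightarrow>\<^sub>E mats (GF q) n n"])
      (auto simp: tensors_def intro!: finite_PiE finite_mats finite_carrier)
  ultimately show "0 < card (rank_codes (GF q) n n r n)"
    using t by (metis card_gt_0_iff gr0I mult_is_0)
qed

lemma order_GL:
  assumes "primepow q"
  shows "order (GL a q) = (\<Prod>j<a. q ^ a - q ^ j)"
proof -
  interpret finite_field "GF q"
    using GF[OF assms] by (simp add: finite_field_def finite_field_axioms_def)
  show ?thesis
    using card_Units_mat_monoid[of a] GF(3)[OF assms]
    by (simp add: GL_def order_def units_of_def)
qed

text \<open>With \<open>P\<close> as below, \<open>P k k\<close> is both the order of the general
  linear group and the denominator of the q-binomial. The code counts differ by the factor
  \<open>P r r / P n n\<close>, which cancels against these denominators and leaves the first form,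
  from which the limits are taken.\<close>

lemma delta_rk_ratio:
  assumes q: "primepow q" and r: "1 \<le> r" "r \<le> n"
  shows "delta_rk q r n n r / delta_rk q n n r n
           = (\<Prod>j<r. real q ^ (n * n) - real q ^ j) / (\<Prod>j<n. real q ^ (r * n) - real q ^ j)"
    and "delta_rk q r n n r / delta_rk q n n r n
           = real (order (GL r q)) / real (order (GL n q))
             * (q_binomial q (n * n) r / q_binomial q (r * n) n)"
proof -
  define P where "P N k = (\<Prod>j<k. real q ^ N - real q ^ j)" for N k :: nat
  have q1: "1 < q" using primepow_gt_Suc_0[OF q] by simp
  \<comment> \<open>For \<open>j < k\<close> the subtraction of naturals does not truncate, so it
    passes to the reals.\<close>
  have real_P: "real (\<Prod>j<k. q ^ k - q ^ j) = P k k" for k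
    unfolding P_def of_nat_prod using q1
    by (intro prod.cong) (auto simp: of_nat_diff power_increasing)
  have P0: "P k k \<noteq> 0" for k
    unfolding P_def using q1 by (auto simp: power_inject_exp)
  have qb: "q_binomial q N k = P N k / P k k" for N k
    unfolding q_binomial_def P_def by (simp add: prod_dividef)
  define N1 N2 where "N1 = real (card (rank_codes (GF q) r n n r))"
    and "N2 = real (card (rank_codes (GF q) n n r n))"
  have eq: "N1 * P n n = N2 * P r r"
    using card_rank_codes_swap(1)[OF q r] unfolding N1_def N2_def real_P[symmetric]
    by (metis of_nat_mult)
  have N2: "N2 \<noteq> 0" using card_rank_codes_swap(2)[OF q r] unfolding N2_def by simp
  have N1: "N1 = N2 * P r r / P n n" using eq P0[of n] by (simp add: field_simps)
  have GL: "real (order (GL a q)) = P a a" for a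
    unfolding order_GL[OF q] real_P ..
  show "delta_rk q r n n r / delta_rk q n n r n
      = (\<Prod>j<r. real q ^ (n * n) - real q ^ j) / (\<Prod>j<n. real q ^ (r * n) - real q ^ j)"
    unfolding delta_rk_def qb P_def[symmetric] N1_def[symmetric] N2_def[symmetric] N1
    using N2 P0[of r] P0[of n] by (simp add: field_simps)
  then show "delta_rk q r n n r / delta_rk q n n r n
      = real (order (GL r q)) / real (order (GL n q)) * (q_binomial q (n * n) r / q_binomial q (r * n) n)"
    unfolding GL qb P_def[symmetric] using P0[of r] P0[of n] by simp
qed

section \<open>Asymptotics of the two products\<close>

lemma prod_power_diff_ratio:
  fixes x :: real
  assumes "x \<noteq> 0"
  shows "(\<Prod>j<r. x ^ (n * n) - x ^ j) / (\<Prod>j<n. x ^ (r * n) - x ^ j)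
           = (\<Prod>j<r. 1 - x ^ j / x ^ (n * n)) / (\<Prod>j<n. 1 - x ^ j / x ^ (r * n))"
proof -
  have P: "(\<Prod>j<k. x ^ N - x ^ j) = x ^ (N * k) * (\<Prod>j<k. 1 - x ^ j / x ^ N)" for N k
  proof -
    have "(\<Prod>j<k. x ^ N - x ^ j) = (\<Prod>j<k. x ^ N * (1 - x ^ j / x ^ N))"
      using assms by (intro prod.cong) (auto simp: field_simps)
    then show ?thesis by (simp add: prod.distrib power_mult)
  qed
  \<comment> \<open>The leading powers extracted from numerator and denominator have the same
    exponent and cancel; this is why the ratio tends to \<open>1\<close>.\<close>
  have exps: "n * n * r = r * n * n" by (simp add: ac_simps)
  show ?thesis unfolding P exps using assms by simp
qed

lemma power_ratio_tendsto_0: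
  assumes "j < N"
  shows "((\<lambda>q. real q ^ j / real q ^ N) \<longlongrightarrow> 0) sequentially"
proof -
  have "filterlim (\<lambda>q. real q ^ (N - j)) at_top sequentially"
    using assms by (intro filterlim_pow_at_top filterlim_real_sequentially) auto
  then have "((\<lambda>q. inverse (real q ^ (N - j))) \<longlongrightarrow> 0) sequentially"
    by (intro tendsto_inverse_0_at_top)
  then show ?thesis
  proof (rule Lim_transform_eventually)
    show "\<forall>\<^sub>F q in sequentially. inverse (real q ^ (N - j)) = real q ^ j / real q ^ N"
      using eventually_gt_at_top[of 0]
    proof eventually_elim
      case (elim q)
      have "real q ^ N = real q ^ (N - j) * real q ^ j"
        using assms by (simp flip: power_add)
      then show ?case using elim by (simp add: field_simps)
    qed
  qed
qed

lemma prod_one_minus_power_ratio_tendsto_1: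
  assumes "k \<le> N"
  shows "((\<lambda>q. \<Prod>j<k. 1 - real q ^ j / real q ^ N) \<longlongrightarrow> 1) sequentially"
proof -
  have "((\<lambda>q. \<Prod>j<k. 1 - real q ^ j / real q ^ N) \<longlongrightarrow> (\<Prod>j<k. 1 - 0)) sequentially"
    using assms by (intro tendsto_prod tendsto_diff tendsto_const power_ratio_tendsto_0) auto
  then show ?thesis by simp
qed

text \<open>For \<open>2 \<le> r\<close> and \<open>j < n\<close> the difference of the exponents
  \<open>r * n - j\<close> is at least \<open>n\<close>, so every factor is at least
  \<open>1 - x^(-n)\<close>, and Bernoulli's inequality bounds the \<open>n\<close>-th power of the
  latter. The lower bound tends to \<open>1\<close> as \<open>n\<close> grows.\<close>

lemma prod_one_minus_power_ratio_bounds: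
  fixes x :: real
  assumes x: "1 < x" and r: "2 \<le> r"
  shows "1 - real n * (1 / x) ^ n \<le> (\<Prod>j<n. 1 - x ^ j / x ^ (r * n))"
    and "(\<Prod>j<n. 1 - x ^ j / x ^ (r * n)) \<le> 1"
proof -
  have le: "x ^ j / x ^ (r * n) \<le> (1 / x) ^ n" if "j < n" for j
  proof -
    have "x ^ j * x ^ n = x ^ (j + n)" by (simp add: power_add)
    also have "\<dots> \<le> x ^ (r * n)"
    proof (rule power_increasing)
      have "2 * n \<le> r * n" using r by (rule mult_le_mono1)
      then show "j + n \<le> r * n" using that by linarith
    qed (use x in simp)
    finally show ?thesis using x by (simp add: field_simps power_one_over)
  qed
  have le1: "(1 / x) ^ n \<le> 1" using x by (intro power_le_one) auto
  have "1 + real n * (- ((1 / x) ^ n)) \<le> (1 + - ((1 / x) ^ n)) ^ n"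
    using le1 by (intro Bernoulli_inequality) auto
  also have "\<dots> = (\<Prod>j<n. 1 - (1 / x) ^ n)" by simp
  also have "\<dots> \<le> (\<Prod>j<n. 1 - x ^ j / x ^ (r * n))"
    using le le1 by (intro prod_mono) auto
  finally show "1 - real n * (1 / x) ^ n \<le> (\<Prod>j<n. 1 - x ^ j / x ^ (r * n))" by simp
  show "(\<Prod>j<n. 1 - x ^ j / x ^ (r * n)) \<le> 1"
  proof (rule prod_le_1)
    fix j assume "j \<in> {..<n}"
    then have "x ^ j / x ^ (r * n) \<le> 1" using le[of j] le1 by simp
    then show "0 \<le> 1 - x ^ j / x ^ (r * n) \<and> 1 - x ^ j / x ^ (r * n) \<le> 1" using x by simp
  qed
qed

text \<open>The limit in \<open>n\<close> is asserted for \<open>2 \<le> r\<close> because it fails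
  for \<open>r = 1\<close>: the denominator is then the product of \<open>1 - q^(-i)\<close> for
  \<open>i\<close> from \<open>1\<close> to \<open>n\<close>, which converges to a number below
  \<open>1\<close>, while the numerator tends to \<open>1\<close>.\<close>

theorem theorem6p3:
  fixes q r n :: nat
  assumes "primepow q" and "1 \<le> r" and "r \<le> n" and "2 \<le> n"
  shows "delta_rk q r n n r / delta_rk q n n r n
           = real (order (GL r q)) / real (order (GL n q))
             * (q_binomial q (n\<^sup>2) r / q_binomial q (r * n) n)
       \<and> ((\<lambda>q'. delta_rk q' r n n r / delta_rk q' n n r n) \<longlongrightarrow> 1)
           (inf at_top (principal {q'. primepow q'}))
       \<and> (2 \<le> r \<longrightarrow> (\<lambda>n'. delta_rk q r n' n' r / delta_rk q n' n' r n') \<longlonglongrightarrow> 1)"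
proof (intro conjI impI)
  show "delta_rk q r n n r / delta_rk q n n r n
           = real (order (GL r q)) / real (order (GL n q))
             * (q_binomial q (n\<^sup>2) r / q_binomial q (r * n) n)"
    using delta_rk_ratio(2)[OF assms(1-3)] by (simp add: power2_eq_square)
next
  \<comment> \<open>The explicit expression has a limit along all naturals. This is then restricted
    to prime powers, where the expression agrees with the ratio of densities.\<close>
  have "((\<lambda>q. (\<Prod>j<r. 1 - real q ^ j / real q ^ (n * n)) / (\<Prod>j<n. 1 - real q ^ j / real q ^ (r * n)))
      \<longlongrightarrow> 1 / 1) sequentially"
  proof (intro tendsto_divide prod_one_minus_power_ratio_tendsto_1)
    show "r \<le> n * n" using assms(3) by (meson le_square order_trans)
    show "n \<le> r * n" using assms(2) by simp
  qed simp
  then have "((\<lambda>q. (\<Prod>j<r. 1 - real q ^ j / real q ^ (n * n)) / (\<Prod>j<n. 1 - real q ^ j / real q ^ (r * n)))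
      \<longlongrightarrow> 1) (inf at_top (principal {q'. primepow q'}))"
    by (auto intro: tendsto_mono[OF inf_le1])
  then show "((\<lambda>q'. delta_rk q' r n n r / delta_rk q' n n r n) \<longlongrightarrow> 1)
      (inf at_top (principal {q'. primepow q'}))"
  proof (rule Lim_transform_eventually)
    show "\<forall>\<^sub>F q in inf at_top (principal {q'. primepow q'}).
        (\<Prod>j<r. 1 - real q ^ j / real q ^ (n * n)) / (\<Prod>j<n. 1 - real q ^ j / real q ^ (r * n))
          = delta_rk q r n n r / delta_rk q n n r n"
      unfolding eventually_inf_principal
    proof (rule always_eventually, intro allI impI)
      fix q :: nat assume "q \<in> {q'. primepow q'}"
      then have q: "primepow q" by simp
      then have "real q \<noteq> 0" using primepow_gt_Suc_0[OF q] by simp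
      then show "(\<Prod>j<r. 1 - real q ^ j / real q ^ (n * n)) / (\<Prod>j<n. 1 - real q ^ j / real q ^ (r * n))
          = delta_rk q r n n r / delta_rk q n n r n"
        using delta_rk_ratio(1)[OF q assms(2,3)] prod_power_diff_ratio[of "real q" n r] by simp
    qed
  qed
next
  assume r: "2 \<le> r"
  have q: "1 < real q" using primepow_gt_Suc_0[OF assms(1)] by simp
  have small: "(\<lambda>n. real n * (1 / real q) ^ n) \<longlonglongrightarrow> 0"
    using q by (intro powser_times_n_limit_0) simp
  \<comment> \<open>The number of factors grows with \<open>n\<close>, so limits of the single
    factors do not suffice and the product is squeezed between uniform bounds. The numerator, in
    contrast, has the fixed number \<open>r\<close> of factors.\<close>
  have den: "(\<lambda>n. \<Prod>j<n. 1 - real q ^ j / real q ^ (r * n)) \<longlonglongrightarrow> 1"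
  proof (rule tendsto_sandwich)
    show "(\<lambda>n. 1 - real n * (1 / real q) ^ n) \<longlonglongrightarrow> 1"
      using tendsto_diff[OF tendsto_const small, of 1] by simp
    show "(\<lambda>n. 1) \<longlonglongrightarrow> (1 :: real)" by simp
  qed (use prod_one_minus_power_ratio_bounds[OF q r] in \<open>auto intro!: always_eventually\<close>)
  have num: "(\<lambda>n. \<Prod>j<r. 1 - real q ^ j / real q ^ (n * n)) \<longlonglongrightarrow> 1"
  proof -
    have "filterlim (\<lambda>n :: nat. n * n) at_top sequentially"
      by (rule filterlim_at_top_mono[OF filterlim_ident]) (auto intro!: always_eventually)
    from filterlim_compose[OF LIMSEQ_realpow_zero this, of "1 / real q"]
    have z: "(\<lambda>n. (1 / real q) ^ (n * n)) \<longlonglongrightarrow> 0" using q by simp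
    have "(\<lambda>n. \<Prod>j<r. 1 - real q ^ j * (1 / real q) ^ (n * n)) \<longlonglongrightarrow> (\<Prod>j<r. 1 - real q ^ j * 0)"
      by (intro tendsto_prod tendsto_diff tendsto_mult tendsto_const z)
    then show ?thesis by (simp add: power_one_over)
  qed
  have "(\<lambda>n. (\<Prod>j<r. 1 - real q ^ j / real q ^ (n * n)) / (\<Prod>j<n. 1 - real q ^ j / real q ^ (r * n))) \<longlonglongrightarrow> 1"
    using tendsto_divide[OF num den] by simp
  then show "(\<lambda>n'. delta_rk q r n' n' r / delta_rk q n' n' r n') \<longlonglongrightarrow> 1"
  proof (rule Lim_transform_eventually)
    show "\<forall>\<^sub>F n in sequentially. (\<Prod>j<r. 1 - real q ^ j / real q ^ (n * n)) /
        (\<Prod>j<n. 1 - real q ^ j / real q ^ (r * n)) = delta_rk q r n n r / delta_rk q n n r n"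
      \<comment> \<open>The formula for the ratio holds only once \<open>n\<close> has reached
        \<open>r\<close>.\<close>
      using eventually_ge_at_top[of r]
    proof eventually_elim
      case (elim n)
      then show ?case
        using delta_rk_ratio(1)[OF assms(1,2) elim] prod_power_diff_ratio[of "real q" n r] q by simp
    qed
  qed
qed

end
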